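(* Let $V$ be a fixed finite set of INF sentences over a vocabulary $\Sigma$ and let $O(V)=\{O_\varphi\mid\varphi\in V\}$. Then for every finite four-valued $\Sigma$-structure $\tilde I$, $\lim_{O(V)}(\tilde I)$ is computable in time polynomial in $|\tilde I|$.
   Context: Vocabularies are finite sets of predicate symbols (equality interpreted as identity). Truth values $\mathbf{t},\mathbf{f},\mathbf{u},\mathbf{i}$; inverse swaps $\mathbf{t},\mathbf{f}$ and fixes $\mathbf{u},\mathbf{i}$. Truth order $\le_t$: $\mathbf{f}\le_t\mathbf{u}\le_t\mathbf{t}$, $\mathbf{f}\le_t\mathbf{i}\le_t\mathbf{t}$. Precision order $\le_p$: $\mathbf{u}\le_p\mathbf{t}\le_p\mathbf{i}$, $\mathbf{u}\le_p\mathbf{f}\le_p\mathbf{i}$. A four-valued $\Sigma$-structure $\tilde I$ has domain $D$ and assigns each $P/n\in\Sigma$ a function $P^{\tilde I}:D^n\to\{\mathbf{t},\mathbf{f},\mathbf{u},\mathbf{i}\}$; $|\tilde I|$ is $|D|$; two-valued structures are identified with ordinary structures. $\le_p$ on structures is pointwise. Formula values $\tilde I\theta(\varphi)$: atoms by $P^{\tilde I}$, $\neg$ by inverse, $\wedge,\forall$ by $\le_t$-glb, $\vee,\exists$ by $\le_t$-lub. An INF sentence is $\forall\overline{x}(\psi\supset L[\overline{x}])$ with $\psi$ having free variables among $\overline{x}$ and $L$ one of $P(\overline{x}),\neg P(\overline{x})$. Its INF propagator $O_\varphi$: $O_\varphi(\tilde I)$ agrees with $\tilde I$ except that for each $\overline{d}$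 with $\tilde I[\overline{x}/\overline{d}](\psi)\ge_p\mathbf{t}$, $P^{O_\varphi(\tilde I)}(\overline{d})=\mathrm{lub}_{\le_p}\{\mathbf{t},P^{\tilde I}(\overline{d})\}$ (resp. $\mathrm{lub}_{\le_p}\{\mathbf{f},P^{\tilde I}(\overline{d})\}$ if $L$ is negative). For a set $W$ of such operators, a $W$-refinement sequence from $\tilde I$ is a (possibly transfinite) sequence $\langle\tilde J_\xi\rangle_{0\le\xi\le\alpha}$ with $\tilde J_0=\tilde I$, $\tilde J_{\xi+1}=O(\tilde J_\xi)$ for some $O\in W$, $\tilde J_\xi<_p\tilde J_{\xi+1}$, and $\tilde J_\lambda=\mathrm{lub}_{\le_p}\{\tilde J_\xi\mid\xi<\lambda\}$ for limit $\lambda$; it is stabilizing if it cannot be extended, i.e. $O(\tilde J_\alpha)=\tilde J_\alpha$ for all $O\in W$. The operators $O_\varphi$ are monotone and inflationary, and all stabilizing $W$-refinement sequences from $\tilde I$ have the same last element, denoted $\lim_W(\tilde I)$. *)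

theory Defs
  imports Main
begin

datatype tv = Tt | Ff | Uu | Ii

definition inv_tv :: "tv \<Rightarrow> tv" where
  "inv_tv v = (case v of Tt \<Rightarrow> Ff | Ff \<Rightarrow> Tt | Uu \<Rightarrow> Uu | Ii \<Rightarrow> Ii)"

definition leq_t :: "tv \<Rightarrow> tv \<Rightarrow> bool" where
  "leq_t a b \<longleftrightarrow> a = b \<or> a = Ff \<or> b = Tt"

definition leq_p :: "tv \<Rightarrow> tv \<Rightarrow> bool" where
  "leq_p a b \<longleftrightarrow> a = b \<or> a = Uu \<or> b = Ii"

definition glb_t :: "tv set \<Rightarrow> tv" where
  "glb_t S = (THE g. (\<forall>x\<in>S. leq_t g x) \<and> (\<forall>h. (\<forall>x\<in>S. leq_t h x) \<longrightarrow> leq_t h g))"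

definition lub_t :: "tv set \<Rightarrow> tv" where
  "lub_t S = (THE g. (\<forall>x\<in>S. leq_t x g) \<and> (\<forall>h. (\<forall>x\<in>S. leq_t x h) \<longrightarrow> leq_t g h))"

definition lub_p :: "tv set \<Rightarrow> tv" where
  "lub_p S = (THE g. (\<forall>x\<in>S. leq_p x g) \<and> (\<forall>h. (\<forall>x\<in>S. leq_p x h) \<longrightarrow> leq_p g h))"

datatype 'p fm =
    Atom 'p "nat list"
  | Eq nat nat
  | Neg "'p fm"
  | Conj "'p fm" "'p fm"
  | Disj "'p fm" "'p fm"
  | All nat "'p fm"
  | Ex nat "'p fm"

fun fv :: "'p fm \<Rightarrow> nat set" where
  "fv (Atom P xs) = set xs"
| "fv (Eq x y) = {x, y}"
| "fv (Neg f) = fv f"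
| "fv (Conj f g) = fv f \<union> fv g"
| "fv (Disj f g) = fv f \<union> fv g"
| "fv (All x f) = fv f - {x}"
| "fv (Ex x f) = fv f - {x}"

text \<open>A vocabulary is given by a list of distinct predicate symbols \<open>sig\<close>
  (its set is \<open>\<Sigma>\<close>, the list fixes an order used only for encoding inputs)
  and an arity function \<open>ar\<close>.\<close>
fun fm_over :: "'p list \<Rightarrow> ('p \<Rightarrow> nat) \<Rightarrow> 'p fm \<Rightarrow> bool" where
  "fm_over sig ar (Atom P xs) = (P \<in> set sig \<and> length xs = ar P)"
| "fm_over sig ar (Eq x y) = True"
| "fm_over sig ar (Neg f) = fm_over sig ar f"
| "fm_over sig ar (Conj f g) = (fm_over sig ar f \<and> fm_over sig ar g)"
| "fm_over sig ar (Disj f g) = (fm_over sig ar f \<and> fm_over sig ar g)"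
| "fm_over sig ar (All x f) = fm_over sig ar f"
| "fm_over sig ar (Ex x f) = fm_over sig ar f"

text \<open>A finite four-valued structure of size \<open>n\<close> has domain \<open>{..<n}\<close> (finite
  structures up to isomorphism) and an interpretation \<open>J\<close>; \<open>J P ds\<close> is the value
  of \<open>P\<close> at the tuple \<open>ds\<close>. Outside the relevant tuples the interpretation is
  normalised to \<open>Uu\<close>, so that a structure is determined by its relevant part.\<close>
type_synonym 'p interp = "'p \<Rightarrow> nat list \<Rightarrow> tv"

definition wf_struct :: "'p list \<Rightarrow> ('p \<Rightarrow> nat) \<Rightarrow> nat \<Rightarrow> 'p interp \<Rightarrow> bool" where
  "wf_struct sig ar n J \<longleftrightarrow>
     (\<forall>P ds. \<not> (P \<in> set sig \<and> length ds = ar P \<and> set ds \<subseteq> {..<n}) \<longrightarrow> J P ds = Uu)"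

definition leq_p_struct :: "'p interp \<Rightarrow> 'p interp \<Rightarrow> bool" where
  "leq_p_struct J K \<longleftrightarrow> (\<forall>P ds. leq_p (J P ds) (K P ds))"

definition lt_p_struct :: "'p interp \<Rightarrow> 'p interp \<Rightarrow> bool" where
  "lt_p_struct J K \<longleftrightarrow> leq_p_struct J K \<and> J \<noteq> K"

fun eval :: "nat \<Rightarrow> 'p interp \<Rightarrow> (nat \<Rightarrow> nat) \<Rightarrow> 'p fm \<Rightarrow> tv" where
  "eval n J \<theta> (Atom P xs) = J P (map \<theta> xs)"
| "eval n J \<theta> (Eq x y) = (if \<theta> x = \<theta> y then Tt else Ff)"
| "eval n J \<theta> (Neg f) = inv_tv (eval n J \<theta> f)"
| "eval n J \<theta> (Conj f g) = glb_t {eval n J \<theta> f, eval n J \<theta> g}"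
| "eval n J \<theta> (Disj f g) = lub_t {eval n J \<theta> f, eval n J \<theta> g}"
| "eval n J \<theta> (All x f) = glb_t ((\<lambda>d. eval n J (\<theta>(x := d)) f) ` {..<n})"
| "eval n J \<theta> (Ex x f) = lub_t ((\<lambda>d. eval n J (\<theta>(x := d)) f) ` {..<n})"

text \<open>\<open>forall xs (psi \<supset> L[xs])\<close>, \<open>L\<close> is \<open>P(xs)\<close> if \<open>inf_pos\<close>, else \<open>\<not>P(xs)\<close>.\<close>
record 'p inf_sentence =
  inf_vars :: "nat list"
  inf_body :: "'p fm"
  inf_pos  :: bool
  inf_pred :: 'p

definition is_INF :: "'p list \<Rightarrow> ('p \<Rightarrow> nat) \<Rightarrow> 'p inf_sentence \<Rightarrow> bool" where
  "is_INF sig ar \<phi> \<longleftrightarrow>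
     distinct (inf_vars \<phi>) \<and> fv (inf_body \<phi>) \<subseteq> set (inf_vars \<phi>) \<and>
     fm_over sig ar (inf_body \<phi>) \<and> inf_pred \<phi> \<in> set sig \<and>
     length (inf_vars \<phi>) = ar (inf_pred \<phi>)"

definition assign :: "nat list \<Rightarrow> nat list \<Rightarrow> nat \<Rightarrow> nat" where
  "assign xs ds v = (case map_of (zip xs ds) v of Some d \<Rightarrow> d | None \<Rightarrow> 0)"

definition INF_prop :: "nat \<Rightarrow> 'p inf_sentence \<Rightarrow> 'p interp \<Rightarrow> 'p interp" where
  "INF_prop n \<phi> J = (\<lambda>Q ds.
     if Q = inf_pred \<phi> \<and> length ds = length (inf_vars \<phi>) \<and> set ds \<subseteq> {..<n}
        \<and> leq_p Tt (eval n J (assign (inf_vars \<phi>) ds) (inf_body \<phi>))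
     then lub_p {if inf_pos \<phi> then Tt else Ff, J Q ds}
     else J Q ds)"

text \<open>For finite structures every refinement sequence is finite (each step strictly
  increases precision of a finite structure), so lists suffice.\<close>
definition refinement_seq :: "('p interp \<Rightarrow> 'p interp) set \<Rightarrow> 'p interp \<Rightarrow> 'p interp list \<Rightarrow> bool" where
  "refinement_seq W J js \<longleftrightarrow> js \<noteq> [] \<and> js ! 0 = J \<and>
     (\<forall>k. Suc k < length js \<longrightarrow>
        (\<exists>Op\<in>W. js ! Suc k = Op (js ! k)) \<and> lt_p_struct (js ! k) (js ! Suc k))"

definition stabilizing_seq :: "('p interp \<Rightarrow> 'p interp) set \<Rightarrow> 'p interp \<Rightarrow> 'p interp list \<Rightarrow> bool" where
  "stabilizing_seq W J js \<longleftrightarrow> refinement_seq W J js \<and> (\<forall>Op\<in>W. Op (last js) = last js)"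

definition lim :: "('p interp \<Rightarrow> 'p interp) set \<Rightarrow> 'p interp \<Rightarrow> 'p interp" where
  "lim W J = (THE K. \<exists>js. stabilizing_seq W J js \<and> last js = K)"

datatype dir = Lft | Rgt | Stay

text \<open>States \<open>{..<tm_states}\<close>, start state 0, halting state 1; tape symbols
  \<open>{..<tm_syms}\<close>, 0 is the blank.\<close>
record tm =
  tm_states :: nat
  tm_syms :: nat
  tm_delta :: "nat \<Rightarrow> nat \<Rightarrow> nat \<times> nat \<times> dir"

definition wf_tm :: "tm \<Rightarrow> bool" where
  "wf_tm M \<longleftrightarrow> 2 \<le> tm_states M \<and> 7 \<le> tm_syms M \<and>
     (\<forall>q<tm_states M. \<forall>s<tm_syms M. case tm_delta M q s of (q', s', d) \<Rightarrow>
        q' < tm_states M \<and> s' < tm_syms M)"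

text \<open>configuration: (state, reversed tape left of head, tape from head on)\<close>
type_synonym config = "nat \<times> nat list \<times> nat list"

fun tm_step :: "tm \<Rightarrow> config \<Rightarrow> config" where
  "tm_step M (q, ls, rs) =
     (if q = 1 then (q, ls, rs) else
      (let s = (case rs of [] \<Rightarrow> 0 | x # _ \<Rightarrow> x) in
       case tm_delta M q s of (q', s', d) \<Rightarrow>
         (case d of
            Stay \<Rightarrow> (q', ls, s' # tl rs)
          | Rgt \<Rightarrow> (q', s' # ls, tl rs)
          | Lft \<Rightarrow> (case ls of [] \<Rightarrow> (q', [], s' # tl rs)
                             | x # ls' \<Rightarrow> (q', ls', x # s' # tl rs)))))"

definition tm_run :: "tm \<Rightarrow> nat \<Rightarrow> nat list \<Rightarrow> config" where
  "tm_run M t w = (tm_step M ^^ t) (0, [], w)"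

definition tm_computes_within :: "tm \<Rightarrow> nat \<Rightarrow> nat list \<Rightarrow> nat list \<Rightarrow> bool" where
  "tm_computes_within M t w v \<longleftrightarrow>
     (case tm_run M t w of (q, ls, rs) \<Rightarrow> q = 1 \<and> takeWhile (\<lambda>s. s \<noteq> 0) rs = v)"

definition code_tv :: "tv \<Rightarrow> nat" where
  "code_tv v = (case v of Tt \<Rightarrow> 3 | Ff \<Rightarrow> 4 | Uu \<Rightarrow> 5 | Ii \<Rightarrow> 6)"

definition encode :: "'p list \<Rightarrow> ('p \<Rightarrow> nat) \<Rightarrow> nat \<Rightarrow> 'p interp \<Rightarrow> nat list" where
  "encode sig ar n J = replicate n 1 @ [2] @
     concat (map (\<lambda>P. map (\<lambda>ds. code_tv (J P ds)) (product_lists (replicate (ar P) [0..<n]))) sig)"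

end

theory Submission
  imports Defs "HOL-Library.Nat_Bijection"
begin

text \<open>The limit is the least structure above the given one that is fixed by all propagators. It is
  reached by repeatedly checking all tuples and updating their values in place: every pass that is
  not yet stable raises the precision of some entry, and each of the polynomially many entries can be
  raised at most twice. Since the sentences are fixed, a pass is a bounded number of nested loops over
  the domain, and the loop variables can be kept as pebbles on the input tape. A program with
  finitely many pebbles runs on a one-tape Turing machine whose symbols record the pebbles on a cell:
  each elementary operation is one sweep over the tape, and the state is the remaining program.\<close>

text \<open>The target is a concrete one-tape machine with a rigid output convention; a transition
  table written directly for this problem would be unmanageable. Compiling a small language
  separates the concerns: total semantics, a step bound that depends only on the program and the
  tape length, and a single proof of correct translation.

  The input starts with the block \<open>1^n 2\<close>. A pebble on cell \<open>i < n\<close> stands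
  for the domain element \<open>i\<close>, so an assignment is a placement of pebbles, equality is a
  comparison of positions, and no number is ever written down.

  The word never grows: applying a propagator simultaneously would need a second copy of the table,
  updating in place needs none. This is legitimate because the limit depends only on the common
  fixed points above the start structure. Stability is not tested either; the number of passes is a
  fixed multiple of the tape length.\<close>

type_synonym cell = "nat \<times> nat set"
type_synonym store = "nat list \<times> (nat \<Rightarrow> nat)"

subsection \<open>Pebble programs\<close>

text \<open>A store \<open>(w, p)\<close> is a tape word with numbered pebbles, \<open>p v\<close> being the position of pebble \<open>v\<close>;
  a position \<open>\<ge> length w\<close> means that the pebble is off the tape. A tape cell \<open>(b, M)\<close> carries the base
  symbol \<open>b\<close> and the set \<open>M\<close> of pebbles lying on it. Pebble 0 never moves and marks the left end.\<close>

datatype oper = Copy nat nat | Inc nat | Join nat bool | Clear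
datatype test = Same nat nat | Base nat "nat set"
datatype cmd = Skip | Op oper | Seq cmd cmd | Cond test cmd cmd | While nat "nat set" cmd

text \<open>\<open>join_code b\<close> is the \<open>leq_p\<close>-join with \<open>Tt\<close> or \<open>Ff\<close> on the codes 3 to 6.\<close>

definition join_code :: "bool \<Rightarrow> nat \<Rightarrow> nat" where
  "join_code b x = (let c = (if b then 3 else 4) in if x = 5 \<or> x = c then c else 6)"

fun act :: "oper \<Rightarrow> store \<Rightarrow> store" where
  "act (Copy u v) (w, p) = (w, p(u := p v))"
| "act (Inc v) (w, p) = (w, p(v := Suc (p v)))"
| "act (Join v b) (w, p) = (w[p v := join_code b (w ! p v)], p)"
| "act Clear (w, p) = (w, \<lambda>v. if v = 0 then 0 else length w)"

text \<open>Off-tape pebbles leave no mark on the tape, so their positions must not influence a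
  test; hence \<open>Same\<close> also asks for a position on the tape.\<close>

fun holds :: "test \<Rightarrow> store \<Rightarrow> bool" where
  "holds (Same u v) (w, p) = (p u = p v \<and> p u < length w)"
| "holds (Base v B) (w, p) = (p v < length w \<and> w ! p v \<in> B)"

text \<open>\<open>While v B c\<close> advances \<open>v\<close> after each round, so unless \<open>c\<close> moves \<open>v\<close> the pebble has left the
  tape after \<open>length w\<close> rounds; this makes the semantics total and the running time syntactic.\<close>

fun exec :: "cmd \<Rightarrow> store \<Rightarrow> store" where
  "exec Skip s = s"
| "exec (Op a) s = act a s"
| "exec (Seq c d) s = exec d (exec c s)"
| "exec (Cond t c d) s = (if holds t s then exec c s else exec d s)"
| "exec (While v B c) s =
     ((\<lambda>s. if holds (Base v B) s then act (Inc v) (exec c s) else s) ^^ length (fst s)) s"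

section \<open>Pebbles moved and pebbles mentioned by a program\<close>

fun act_mods :: "oper \<Rightarrow> nat set" where
  "act_mods (Copy u v) = {u}"
| "act_mods (Inc v) = {v}"
| "act_mods (Join v b) = {}"
| "act_mods Clear = - {0}"

fun act_vars :: "oper \<Rightarrow> nat set" where
  "act_vars (Copy u v) = {u, v}"
| "act_vars (Inc v) = {v}"
| "act_vars (Join v b) = {v}"
| "act_vars Clear = {}"

fun test_vars :: "test \<Rightarrow> nat set" where
  "test_vars (Same u v) = {u, v}"
| "test_vars (Base v B) = {v}"

fun mods :: "cmd \<Rightarrow> nat set" where
  "mods Skip = {}"
| "mods (Op a) = act_mods a"
| "mods (Seq c d) = mods c \<union> mods d"
| "mods (Cond t c d) = mods c \<union> mods d"
| "mods (While v B c) = insert v (mods c)"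

fun vars :: "cmd \<Rightarrow> nat set" where
  "vars Skip = {}"
| "vars (Op a) = act_vars a"
| "vars (Seq c d) = vars c \<union> vars d"
| "vars (Cond t c d) = test_vars t \<union> vars c \<union> vars d"
| "vars (While v B c) = insert v (vars c)"

fun wf_cmd :: "cmd \<Rightarrow> bool" where
  "wf_cmd (Seq c d) = (wf_cmd c \<and> wf_cmd d)"
| "wf_cmd (Cond t c d) = (wf_cmd c \<and> wf_cmd d)"
| "wf_cmd (While v B c) = (v \<notin> mods c \<and> wf_cmd c)"
| "wf_cmd _ = True"

lemma finite_vars: "finite (vars c)"
proof (induction c)
  case (Op a) then show ?case by (cases a) auto
next
  case (Cond t c d) then show ?case by (cases t) auto
qed auto

lemma length_act [simp]: "length (fst (act a s)) = length (fst s)"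
  by (cases s; cases a) auto

lemma act_Clear: "act Clear s = (fst s, \<lambda>v. if v = 0 then 0 else length (fst s))"
  by (metis act.simps(4) prod.collapse)

text \<open>\<open>Clear\<close> puts pebble 0 at position 0, which leaves it unmoved only if it was
  there before; hence the premise on pebble 0, inherited by \<open>exec_mods\<close>.\<close>

lemma act_mods: "v \<notin> act_mods a \<Longrightarrow> snd s 0 = 0 \<Longrightarrow> snd (act a s) v = snd s v"
  by (cases s; cases a) auto

lemma funpow_inv: "P s \<Longrightarrow> (\<And>s. P s \<Longrightarrow> P (f s)) \<Longrightarrow> P ((f ^^ n) s)"
  by (induction n) auto

lemma length_exec [simp]: "length (fst (exec c s)) = length (fst s)"
proof (induction c arbitrary: s)
  case (While v B c)
  show ?case unfolding exec.simps
    by (rule funpow_inv[where P = "\<lambda>s'. length (fst s') = length (fst s)"]) (auto simp: While)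
qed auto

lemma exec_mods: "v \<notin> mods c \<Longrightarrow> 0 \<notin> mods c \<Longrightarrow> snd s 0 = 0 \<Longrightarrow> snd (exec c s) v = snd s v"
proof (induction c arbitrary: s v)
  case (Op a) then show ?case by (simp add: act_mods)
next
  case (Seq c d)
  from Seq.prems show ?case by (simp add: Seq.IH)
next
  case (While x B c)
  have "snd (exec (While x B c) s) v = snd s v \<and> snd (exec (While x B c) s) 0 = 0"
    unfolding exec.simps
    by (rule funpow_inv[where P = "\<lambda>s'. snd s' v = snd s v \<and> snd s' 0 = 0"])
       (use While in \<open>auto simp: act_mods\<close>)
  then show ?case by simp
qed auto

lemma exec_zero: "0 \<notin> mods c \<Longrightarrow> snd s 0 = 0 \<Longrightarrow> snd (exec c s) 0 = 0"
  by (simp add: exec_mods)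

lemma join_code_bounds: "0 < join_code b x" "join_code b x < 7"
  by (auto simp: join_code_def Let_def)

lemma act_nonzero: "0 \<notin> set (fst s) \<Longrightarrow> 0 \<notin> set (fst (act a s))"
proof (cases s)
  case (Pair w p)
  show "0 \<notin> set (fst s) \<Longrightarrow> 0 \<notin> set (fst (act a s))" unfolding Pair
  proof (cases a)
    case (Join v b)
    show "0 \<notin> set (fst (w, p)) \<Longrightarrow> 0 \<notin> set (fst (act a (w, p)))"
      unfolding Join using join_code_bounds(1)[of b "w ! p v"]
        set_update_subset_insert[of w "p v" "join_code b (w ! p v)"] by auto
  qed auto
qed

lemma exec_nonzero: "0 \<notin> set (fst s) \<Longrightarrow> 0 \<notin> set (fst (exec c s))"
proof (induction c arbitrary: s)
  case (While v B c)
  show ?case unfolding exec.simps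
    by (rule funpow_inv[where P = "\<lambda>s'. 0 \<notin> set (fst s')"])
      (use While act_nonzero in \<open>auto simp del: act.simps\<close>)
qed (auto simp: act_nonzero)

section \<open>One command as a left-to-right automaton on cells\<close>

fun act_cell :: "oper \<Rightarrow> bool \<Rightarrow> cell \<Rightarrow> bool \<times> cell" where
  "act_cell (Copy u v) r (b, M) = (r, b, if v \<in> M then insert u M else M - {u})"
| "act_cell (Inc v) r (b, M) = (v \<in> M, b, if r then insert v M else M - {v})"
| "act_cell (Join v c) r (b, M) = (r, if v \<in> M then join_code c b else b, M)"
| "act_cell Clear r (b, M) = (r, b, M \<inter> {0})"

fun test_cell :: "test \<Rightarrow> cell \<Rightarrow> bool" where
  "test_cell (Same u v) (b, M) = (u \<in> M \<and> v \<in> M)"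
| "test_cell (Base v B) (b, M) = (v \<in> M \<and> b \<in> B)"

text \<open>The bit is all that cells tell each other: under \<open>Inc v\<close> it says that the
  cell just read held \<open>v\<close>, which must reappear on this one; under a test it says that
  some cell read so far passed.\<close>

fun cmd_cell :: "cmd \<Rightarrow> bool \<Rightarrow> cell \<Rightarrow> bool \<times> cell" where
  "cmd_cell (Op a) r x = act_cell a r x"
| "cmd_cell (Cond t c d) r x = (r \<or> test_cell t x, x)"
| "cmd_cell (While v B c) r x = (r \<or> test_cell (Base v B) x, x)"
| "cmd_cell _ r x = (r, x)"

text \<open>\<open>While\<close> unfolds to its body, its increment and itself, so no continuation
  grows with the number of rounds. This keeps the control finite.\<close>

fun next_conts :: "cmd list \<Rightarrow> bool \<Rightarrow> cmd list" where
  "next_conts (Cond t c d # K) r = (if r then c else d) # K"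
| "next_conts (While v B c # K) r = (if r then c # Op (Inc v) # While v B c # K else K)"
| "next_conts (_ # K) r = K"
| "next_conts [] r = []"

text \<open>The finite control stores the list of commands still to be executed (a continuation);
  \<open>Fwd\<close> and \<open>Bwd\<close> sweep the tape for the head of that list, carrying one bit.\<close>

datatype control = Start | Halt | Run "cmd list" | Fwd "cmd list" bool | Bwd "cmd list" bool

text \<open>With nothing left to do the head is on the left end, whose pebble 0 must vanish before
  the tape can be read as output.\<close>

fun run_delta :: "cmd list \<Rightarrow> cell \<Rightarrow> control \<times> cell" where
  "run_delta [] x = (Halt, fst x, {})"
| "run_delta (Skip # K) x = (Run K, x)"
| "run_delta (Seq c d # K) x = (Run (c # d # K), x)"
| "run_delta K x = (Fwd K False, x)"

text \<open>Words contain no 0, so a forward sweep turns at the first blank; a backward sweep ends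
  at pebble 0. Intersecting with \<open>{..<m}\<close> keeps the alphabet finite whatever the
  program.\<close>

fun delta :: "nat \<Rightarrow> cmd \<Rightarrow> control \<Rightarrow> cell \<Rightarrow> control \<times> cell \<times> dir" where
  "delta m c Start x = (Run [c], (fst x, insert 0 (snd x)), Stay)"
| "delta m c Halt x = (Halt, x, Stay)"
| "delta m c (Run K) x = (let (q, y) = run_delta K x in (q, y, Stay))"
| "delta m c (Fwd K r) x =
     (if fst x = 0 then (Bwd K r, x, Lft)
      else let (r', b, M) = cmd_cell (hd K) r x in (Fwd K r', (b, M \<inter> {..<m}), Rgt))"
| "delta m c (Bwd K r) x =
     (if 0 \<in> snd x then (Run (next_conts K r), x, Stay) else (Bwd K r, x, Lft))"

abbreviation blank :: cell where "blank \<equiv> (0, {})"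

text \<open>A copy of \<open>tm_step\<close> on structured states and cells;
  \<open>machine_exists\<close> transfers its runs along the coding.\<close>

fun astep :: "nat \<Rightarrow> cmd \<Rightarrow> control \<times> cell list \<times> cell list \<Rightarrow> control \<times> cell list \<times> cell list" where
  "astep m c (q, ls, rs) = (if q = Halt then (q, ls, rs) else
     (case delta m c q (case rs of [] \<Rightarrow> blank | x # _ \<Rightarrow> x) of (q', y, d) \<Rightarrow>
       (case d of
          Stay \<Rightarrow> (q', ls, y # tl rs)
        | Rgt \<Rightarrow> (q', y # ls, tl rs)
        | Lft \<Rightarrow> (case ls of [] \<Rightarrow> (q', [], y # tl rs) | x # ls' \<Rightarrow> (q', ls', x # y # tl rs)))))"

definition cell_at :: "nat \<Rightarrow> store \<Rightarrow> nat \<Rightarrow> cell" where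
  "cell_at m s i = (fst s ! i, {v. v < m \<and> snd s v = i})"

definition tape :: "nat \<Rightarrow> store \<Rightarrow> cell list" where
  "tape m s = map (cell_at m s) [0..<length (fst s)]"

fun after :: "cmd \<Rightarrow> store \<Rightarrow> store" where
  "after (Op a) s = act a s"
| "after _ s = s"

text \<open>The bit left over at the right end of the tape: the answer of a test, or, for
  \<open>Inc\<close>, that the pebble has just moved off the tape.\<close>

fun result :: "cmd \<Rightarrow> store \<Rightarrow> bool" where
  "result (Cond t c d) s = holds t s"
| "result (While v B c) s = holds (Base v B) s"
| "result (Op (Inc v)) s = (Suc (snd s v) = length (fst s))"
| "result _ s = False"

text \<open>The one-bit state of the left-to-right sweep for a command just before it reads cell \<open>j\<close>.\<close>

fun sweep_bit :: "cmd \<Rightarrow> store \<Rightarrow> nat \<Rightarrow> bool" where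
  "sweep_bit (Op (Inc v)) s j = (Suc (snd s v) = j)"
| "sweep_bit (Cond (Same u v) c d) s j = (snd s u = snd s v \<and> snd s u < j)"
| "sweep_bit (Cond (Base v B) c d) s j = (snd s v < j \<and> fst s ! snd s v \<in> B)"
| "sweep_bit (While v B c) s j = (snd s v < j \<and> fst s ! snd s v \<in> B)"
| "sweep_bit _ s j = False"

lemma sweep_bit_0: "sweep_bit c s 0 = False"
  by (cases "(c, s, 0::nat)" rule: sweep_bit.cases) auto

lemma sweep_bit_length: "sweep_bit c s (length (fst s)) = result c s"
  by (cases s; cases "(c, s, 0::nat)" rule: sweep_bit.cases) auto

text \<open>Pebble 0 at position 0 makes \<open>M \<inter> {0}\<close> agree with
  \<open>Clear\<close>, and the bound on \<open>vars c\<close> makes the truncation to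
  \<open>{..<m}\<close> harmless.\<close>

lemma cmd_cell_sweep:
  assumes "vars c \<subseteq> {..<m}" "0 < m" "snd s 0 = 0" "j < length (fst s)"
    "\<And>x y. c \<noteq> Seq x y" "c \<noteq> Skip"
  shows "(let (r', b, M) = cmd_cell c (sweep_bit c s j) (cell_at m s j) in (r', b, M \<inter> {..<m})) =
         (sweep_bit c s (Suc j), cell_at m (after c s) j)"
proof (cases s)
  case (Pair w p)
  show ?thesis
    using assms unfolding Pair
    by (cases "(c, s, 0::nat)" rule: sweep_bit.cases)
      (auto simp: cell_at_def less_Suc_eq nth_list_update)
qed


subsection \<open>Turing machine simulation of pebble programs\<close>

definition reach :: "nat \<Rightarrow> cmd \<Rightarrow> nat \<Rightarrow> control \<times> cell list \<times> cell list \<Rightarrow> control \<times> cell list \<times> cell list \<Rightarrow> bool"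
  where "reach m c0 t x y \<longleftrightarrow> (\<exists>t'\<le>t. (astep m c0 ^^ t') x = y)"

lemma reach_trans: "reach m c0 a x y \<Longrightarrow> reach m c0 b y z \<Longrightarrow> reach m c0 (a + b) x z"
  unfolding reach_def
proof (elim exE conjE)
  fix s t assume "s \<le> a" "(astep m c0 ^^ s) x = y" "t \<le> b" "(astep m c0 ^^ t) y = z"
  then show "\<exists>t'\<le>a + b. (astep m c0 ^^ t') x = z"
    by (intro exI[of _ "t + s"]) (auto simp: funpow_add)
qed

lemma reach_step: "astep m c0 x = y \<Longrightarrow> reach m c0 1 x y"
  unfolding reach_def by (intro exI[of _ 1]) auto

lemma reach_mono: "reach m c0 a x y \<Longrightarrow> a \<le> b \<Longrightarrow> reach m c0 b x y"
  unfolding reach_def using le_trans by blast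

lemma length_after [simp]: "length (fst (after X s)) = length (fst s)"
  by (cases X) auto

lemma cell_at_0: "0 < m \<Longrightarrow> snd s 0 = 0 \<Longrightarrow> 0 \<in> snd (cell_at m s i) \<longleftrightarrow> i = 0"
  by (auto simp: cell_at_def)

definition is_sweep :: "cmd \<Rightarrow> bool" where
  "is_sweep c \<longleftrightarrow> (\<forall>x y. c \<noteq> Seq x y) \<and> c \<noteq> Skip"

lemma sweep_forward:
  assumes X: "vars X \<subseteq> {..<m}" "0 < m" "snd s 0 = 0" "is_sweep X" "0 \<notin> set (fst s)"
  shows "j \<le> length (fst s) \<Longrightarrow>
    (astep m c0 ^^ j) (Fwd (X # K) False, [], tape m s @ E) =
    (Fwd (X # K) (sweep_bit X s j), rev (map (cell_at m (after X s)) [0..<j]),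
     map (cell_at m s) [j..<length (fst s)] @ E)"
proof (induction j)
  case 0
  then show ?case by (simp add: tape_def sweep_bit_0)
next
  case (Suc j)
  then have j: "j < length (fst s)" by simp
  have nz: "fst (cell_at m s j) \<noteq> 0"
    using nth_mem[OF j] X(5) by (metis cell_at_def fst_conv)
  have "(let (r', b, M) = cmd_cell X (sweep_bit X s j) (cell_at m s j) in (r', b, M \<inter> {..<m})) =
         (sweep_bit X s (Suc j), cell_at m (after X s) j)"
    using X j by (intro cmd_cell_sweep) (auto simp: is_sweep_def)
  then have "delta m c0 (Fwd (X # K) (sweep_bit X s j)) (cell_at m s j) =
      (Fwd (X # K) (sweep_bit X s (Suc j)), cell_at m (after X s) j, Rgt)"
    using nz by (auto split: prod.splits)
  then show ?case
    using Suc j by (simp del: delta.simps add: upt_rec[of j])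
qed

lemma sweep_backward:
  assumes "0 < m" "snd s 0 = 0" "j < n"
  shows "(astep m c0 ^^ j) (Bwd K r, rev (map (cell_at m s) [0..<j]), map (cell_at m s) [j..<n] @ E) =
    (Bwd K r, [], map (cell_at m s) [0..<n] @ E)"
  using assms(3)
proof (induction j)
  case (Suc j)
  have "astep m c0 (Bwd K r, rev (map (cell_at m s) [0..<Suc j]), map (cell_at m s) [Suc j..<n] @ E) =
    (Bwd K r, rev (map (cell_at m s) [0..<j]), map (cell_at m s) [j..<n] @ E)"
    using Suc.prems assms(1,2) by (simp add: upt_rec[of "Suc j"] upt_rec[of j] cell_at_0)
  then show ?case using Suc by (simp only: funpow_Suc_right o_apply)
qed simp

text \<open>On \<open>Suc n\<close> cells: one step to start, \<open>Suc n\<close> to the right, one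
  to turn, \<open>n\<close> to the left, one to finish; together
  \<open>2 * Suc n + 2\<close>.\<close>

lemma sweep:
  assumes X: "vars X \<subseteq> {..<m}" "0 < m" "snd s 0 = 0" "is_sweep X" "0 \<notin> set (fst s)"
    and N: "fst s \<noteq> []" and z: "snd (after X s) 0 = 0"
  shows "\<exists>e'. reach m c0 (2 * length (fst s) + 2) (Run (X # K), [], tape m s @ replicate e blank)
     (Run (next_conts (X # K) (result X s)), [], tape m (after X s) @ replicate e' blank)"
proof -
  define n where "n = length (fst s) - 1"
  have len: "length (fst s) = Suc n" using N by (cases "fst s") (auto simp: n_def)
  \<comment> \<open>Turning rewrites the first blank, so afterwards at least one explicit blank
    follows the word. Hence the number of trailing blanks is existential.\<close>
  define E' where "E' = blank # tl (replicate e blank)"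
  have E': "E' = replicate (Suc (e - 1)) blank"
    unfolding E'_def by (cases e) auto
  let ?g = "cell_at m (after X s)"
  have "reach m c0 1 (Run (X # K), [], tape m s @ replicate e blank) (Fwd (X # K) False, [], tape m s @ replicate e blank)"
    using X(4) by (intro reach_step) (cases X; simp add: is_sweep_def tape_def len upt_rec[of 0])
  moreover have "reach m c0 (Suc n) (Fwd (X # K) False, [], tape m s @ replicate e blank)
     (Fwd (X # K) (result X s), rev (map ?g [0..<Suc n]), replicate e blank)"
    using sweep_forward[OF X, of "Suc n" c0 K "replicate e blank"] sweep_bit_length[of X s] len
    unfolding reach_def by auto
  moreover have "reach m c0 1 (Fwd (X # K) (result X s), rev (map ?g [0..<Suc n]), replicate e blank)
      (Bwd (X # K) (result X s), rev (map ?g [0..<n]), map ?g [n..<Suc n] @ E')"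
    by (intro reach_step) (cases e; simp add: E'_def)
  moreover have "reach m c0 n (Bwd (X # K) (result X s), rev (map ?g [0..<n]), map ?g [n..<Suc n] @ E')
      (Bwd (X # K) (result X s), [], map ?g [0..<Suc n] @ E')"
    using sweep_backward[OF X(2) z, of n "Suc n" c0] unfolding reach_def by blast
  moreover have "reach m c0 1 (Bwd (X # K) (result X s), [], map ?g [0..<Suc n] @ E')
      (Run (next_conts (X # K) (result X s)), [], map ?g [0..<Suc n] @ E')"
    using cell_at_0[OF X(2) z, of 0]
    by (intro reach_step) (simp del: upt_Suc add: upt_rec[of 0])
  ultimately have "reach m c0 (1 + Suc n + 1 + n + 1) (Run (X # K), [], tape m s @ replicate e blank)
      (Run (next_conts (X # K) (result X s)), [], map ?g [0..<Suc n] @ E')"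
    by (blast intro: reach_trans)
  then show ?thesis
    unfolding E' tape_def len length_after
    by (intro exI[of _ "Suc (e - 1)"]) (auto elim: reach_mono)
qed

text \<open>A round of \<open>While\<close> has two sweeps of its own, for the test and the
  increment, and \<open>N + 1\<close> counts the final failing test. \<open>Cond\<close> pays for
  both branches, so that the bound does not depend on the data.\<close>

fun time :: "cmd \<Rightarrow> nat \<Rightarrow> nat" where
  "time Skip N = 1"
| "time (Op a) N = 2 * N + 2"
| "time (Seq c d) N = 1 + time c N + time d N"
| "time (Cond t c d) N = 2 * N + 2 + time c N + time d N"
| "time (While v B c) N = (N + 1) * (4 * N + 4 + time c N)"

section \<open>Simulation of whole programs\<close>

definition simulated :: "nat \<Rightarrow> cmd \<Rightarrow> nat \<Rightarrow> cmd list \<Rightarrow> cmd list \<Rightarrow> store \<Rightarrow> store \<Rightarrow> bool" where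
  "simulated m c0 t K K' s s' \<longleftrightarrow> (\<forall>e. \<exists>e'. reach m c0 t (Run K, [], tape m s @ replicate e blank)
     (Run K', [], tape m s' @ replicate e' blank))"

lemma simulated_trans:
  "simulated m c0 a K K' s s' \<Longrightarrow> simulated m c0 b K' K'' s' s'' \<Longrightarrow> simulated m c0 (a + b) K K'' s s''"
  unfolding simulated_def by (meson reach_trans)

lemma simulated_mono: "simulated m c0 a K K' s s' \<Longrightarrow> a \<le> b \<Longrightarrow> simulated m c0 b K K' s s'"
  unfolding simulated_def by (meson reach_mono)

definition ok_store :: "store \<Rightarrow> bool" where
  "ok_store s \<longleftrightarrow> snd s 0 = 0 \<and> 0 \<notin> set (fst s) \<and> fst s \<noteq> []"

lemma ok_exec: "ok_store s \<Longrightarrow> 0 \<notin> mods c \<Longrightarrow> ok_store (exec c s)"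
  unfolding ok_store_def using exec_nonzero exec_zero length_exec by (metis length_0_conv)

lemma ok_act: "ok_store s \<Longrightarrow> 0 \<notin> act_mods a \<Longrightarrow> ok_store (act a s)"
  using ok_exec[of s "Op a"] by simp

lemma simulated_sweep:
  assumes "vars X \<subseteq> {..<m}" "0 < m" "is_sweep X" "ok_store s" "0 \<notin> mods X"
  shows "simulated m c0 (2 * length (fst s) + 2) (X # K) (next_conts (X # K) (result X s)) s (after X s)"
  unfolding simulated_def
proof
  fix e
  have "snd (after X s) 0 = 0"
    using assms by (cases X) (auto simp: ok_store_def act_mods)
  then show "\<exists>e'. reach m c0 (2 * length (fst s) + 2) (Run (X # K), [], tape m s @ replicate e blank)
     (Run (next_conts (X # K) (result X s)), [], tape m (after X s) @ replicate e' blank)"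
    using assms by (intro sweep) (auto simp: ok_store_def)
qed

lemma simulated_first:
  assumes "run_delta K = (\<lambda>x. (Run K', x))" "ok_store s"
  shows "simulated m c0 1 K K' s s"
  unfolding simulated_def
proof
  fix e
  obtain n where "length (fst s) = Suc n"
    using assms(2) by (cases "fst s") (auto simp: ok_store_def)
  then show "\<exists>e'. reach m c0 1 (Run K, [], tape m s @ replicate e blank)
     (Run K', [], tape m s @ replicate e' blank)"
    using assms(1) by (intro exI[of _ e] reach_step) (simp del: upt_Suc add: tape_def upt_rec[of 0])
qed

lemma funpow_fixed: "f x = x \<Longrightarrow> (f ^^ n) x = x"
  by (induction n) auto

lemma simulated_exec:
  assumes "0 < m"
  shows "vars c \<subseteq> {..<m} \<Longrightarrow> 0 \<notin> mods c \<Longrightarrow> wf_cmd c \<Longrightarrow> ok_store s \<Longrightarrow>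
    simulated m c0 (time c (length (fst s))) (c # K) K s (exec c s)"
proof (induction c arbitrary: s K)
  case Skip
  then show ?case using simulated_first[of "Skip # K" K s] by (simp add: fun_eq_iff)
next
  case (Op a)
  then show ?case
    using simulated_sweep[OF _ assms, of "Op a" s c0 K] by (simp add: is_sweep_def)
next
  case (Seq c d)
  have "simulated m c0 1 (Seq c d # K) (c # d # K) s s"
    using Seq.prems by (intro simulated_first) auto
  moreover have "simulated m c0 (time c (length (fst s))) (c # d # K) (d # K) s (exec c s)"
    using Seq.prems by (intro Seq.IH) auto
  moreover have "simulated m c0 (time d (length (fst (exec c s)))) (d # K) K (exec c s) (exec d (exec c s))"
    using Seq.prems by (intro Seq.IH) (auto intro: ok_exec)
  ultimately show ?case by (auto dest: simulated_trans)
next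
  case (Cond t c d)
  have "simulated m c0 (2 * length (fst s) + 2) (Cond t c d # K) ((if holds t s then c else d) # K) s s"
    using simulated_sweep[OF _ assms, of "Cond t c d" s c0 K] Cond.prems by (simp add: is_sweep_def)
  moreover have "simulated m c0 (time c (length (fst s)) + time d (length (fst s)))
    ((if holds t s then c else d) # K) K s (exec (Cond t c d) s)"
    using Cond.IH(1)[of s K] Cond.IH(2)[of s K] Cond.prems by (auto intro: simulated_mono)
  ultimately show ?case using simulated_trans by (fastforce simp: add.assoc)
next
  case (While v B c)
  let ?N = "length (fst s)"
  let ?f = "\<lambda>s. if holds (Base v B) s then act (Inc v) (exec c s) else s"
  \<comment> \<open>Generalised to a pebble that leaves the tape after at most \<open>j\<close> more
    rounds; at \<open>j = 0\<close> only the failing test remains.\<close>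
  have iter: "simulated m c0 ((j + 1) * (4 * ?N + 4 + time c ?N)) (While v B c # K) K s' ((?f ^^ j) s')"
    if "ok_store s'" "length (fst s') = ?N" "?N \<le> snd s' v + j" for s' j
    using that
  proof (induction j arbitrary: s')
    case (0 s')
    have "\<not> holds (Base v B) s'" using 0 by (cases s') auto
    then have "simulated m c0 (2 * ?N + 2) (While v B c # K) K s' s'"
      using simulated_sweep[OF _ assms, of "While v B c" s' c0 K] While.prems 0 by (simp add: is_sweep_def)
    then show ?case by (auto intro: simulated_mono)
  next
    case (Suc j s')
    show ?case
    proof (cases "holds (Base v B) s'")
      case False
      then have "simulated m c0 (2 * ?N + 2) (While v B c # K) K s' s'"
        using simulated_sweep[OF _ assms, of "While v B c" s' c0 K] While.prems Suc by (simp add: is_sweep_def)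
      moreover have "(?f ^^ Suc j) s' = s'" using False by (intro funpow_fixed) simp
      ultimately show ?thesis by (auto intro: simulated_mono)
    next
      case True
      let ?s = "act (Inc v) (exec c s')"
      have ok: "ok_store (exec c s')" "ok_store ?s"
        using Suc.prems(1) While.prems by (auto intro!: ok_exec ok_act)
      have "snd (exec c s') v = snd s' v"
        using While.prems Suc.prems by (intro exec_mods) (auto simp: ok_store_def)
      then have p: "snd ?s v = Suc (snd s' v)" by (cases "exec c s'") auto
      have "simulated m c0 (2 * ?N + 2) (While v B c # K) (c # Op (Inc v) # While v B c # K) s' s'"
        using simulated_sweep[OF _ assms, of "While v B c" s' c0 K] While.prems True Suc.prems
        by (simp add: is_sweep_def)
      moreover have "simulated m c0 (time c ?N) (c # Op (Inc v) # While v B c # K)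
          (Op (Inc v) # While v B c # K) s' (exec c s')"
        using While.IH[of s' "Op (Inc v) # While v B c # K"] While.prems Suc.prems by simp
      moreover have "simulated m c0 (2 * ?N + 2) (Op (Inc v) # While v B c # K) (While v B c # K) (exec c s') ?s"
        using simulated_sweep[OF _ assms, of "Op (Inc v)" "exec c s'" c0 "While v B c # K"]
          While.prems Suc.prems ok by (simp add: is_sweep_def)
      moreover have "simulated m c0 ((j + 1) * (4 * ?N + 4 + time c ?N)) (While v B c # K) K ?s ((?f ^^ j) ?s)"
        using Suc.prems ok p by (intro Suc.IH) auto
      ultimately have "simulated m c0 ((2 * ?N + 2) + time c ?N + (2 * ?N + 2) +
          (j + 1) * (4 * ?N + 4 + time c ?N)) (While v B c # K) K s' ((?f ^^ j) ?s)"
        by (blast intro: simulated_trans)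
      moreover have "(?f ^^ Suc j) s' = (?f ^^ j) ?s"
        using True by (simp only: funpow_Suc_right o_apply) simp
      ultimately show ?thesis by (auto intro: simulated_mono)
    qed
  qed
  show ?case using iter[of s ?N] While.prems by simp
qed


section \<open>Finiteness of the control and of the cell alphabet\<close>

fun conts :: "cmd \<Rightarrow> cmd list \<Rightarrow> cmd list set" where
  "conts Skip K = {Skip # K}"
| "conts (Op a) K = {Op a # K}"
| "conts (Seq c d) K = insert (Seq c d # K) (conts c (d # K) \<union> conts d K)"
| "conts (Cond t c d) K = insert (Cond t c d # K) (conts c K \<union> conts d K)"
| "conts (While v B c) K =
     {While v B c # K, Op (Inc v) # While v B c # K} \<union> conts c (Op (Inc v) # While v B c # K)"

lemma finite_conts: "finite (conts c K)"
  by (induction c arbitrary: K) auto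

lemma conts_self: "c # K \<in> conts c K"
  by (cases c) auto

lemma next_conts_closed: "k \<in> conts c K \<Longrightarrow> next_conts k r \<in> insert K (conts c K)"
proof (induction c arbitrary: K)
  case (Seq c d)
  from Seq.prems consider "k = Seq c d # K" | "k \<in> conts c (d # K)" | "k \<in> conts d K" by auto
  then show ?case
  proof cases
    case 1
    then show ?thesis by simp
  next
    case 2
    from Seq.IH(1)[OF this] show ?thesis using conts_self[of d K] by auto
  next
    case 3
    from Seq.IH(2)[OF this] show ?thesis by auto
  qed
next
  case (Cond t c d)
  then show ?case using conts_self[of c K] conts_self[of d K] by auto
next
  case (While v B c)
  let ?K = "Op (Inc v) # While v B c # K"
  from While.prems consider "k = While v B c # K" | "k = ?K" | "k \<in> conts c ?K" by auto
  then show ?case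
  proof cases
    case 1
    then show ?thesis using conts_self[of c ?K] by (cases r) auto
  next
    case 2
    then show ?thesis by simp
  next
    case 3
    from While.IH[OF this] show ?thesis by auto
  qed
qed auto

lemma run_delta_closed:
  "k \<in> conts c K \<Longrightarrow> fst (run_delta k x) \<in> {Fwd k False} \<union> Run ` insert K (conts c K)"
proof (induction c arbitrary: K)
  case (Seq c d)
  have "fst (run_delta k x) \<in> {Fwd k False} \<union> Run ` insert K (conts (Seq c d) K)"
    if "k \<in> conts c (d # K)"
    using Seq.IH(1)[OF that] conts_self[of d K] by auto
  moreover have "fst (run_delta k x) \<in> {Fwd k False} \<union> Run ` insert K (conts (Seq c d) K)"
    if "k \<in> conts d K"
    using Seq.IH(2)[OF that] by auto
  ultimately show ?case using Seq.prems conts_self[of c "d # K"] by auto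
next
  case (Cond t c d)
  then show ?case using Cond.IH(1)[of K] Cond.IH(2)[of K] by auto
next
  case (While v B c)
  then show ?case using While.IH[of "Op (Inc v) # While v B c # K"] by auto
qed auto

definition controls :: "cmd \<Rightarrow> control set" where
  "controls c = (let C = insert [] (conts c []) in
     {Start, Halt} \<union> Run ` C \<union> (\<Union>r. (\<lambda>K. Fwd K r) ` C) \<union> (\<Union>r. (\<lambda>K. Bwd K r) ` C))"

lemma finite_controls: "finite (controls c)"
  by (simp add: controls_def finite_conts)

definition cells :: "nat \<Rightarrow> cell set" where
  "cells m = {..<7} \<times> Pow {..<m}"

lemma cmd_cell_bound: "fst x < 7 \<Longrightarrow> fst (snd (cmd_cell c r x)) < 7"
proof (cases c)
  case (Op a)
  then show "fst x < 7 \<Longrightarrow> fst (snd (cmd_cell c r x)) < 7"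
    by (cases a; cases x) (auto simp: join_code_bounds)
qed auto

lemma delta_closed:
  assumes "0 < m" "q \<in> controls c" "x \<in> cells m"
  shows "fst (delta m c q x) \<in> controls c" "fst (snd (delta m c q x)) \<in> cells m"
proof -
  have "fst (delta m c q x) \<in> controls c \<and> fst (snd (delta m c q x)) \<in> cells m"
  proof (cases q)
    case Start
    then show ?thesis using assms conts_self[of c "[]"] by (auto simp: controls_def cells_def)
  next
    case Halt
    then show ?thesis using assms by simp
  next
    case (Run k)
    then have k: "k \<in> insert [] (conts c [])" using assms by (auto simp: controls_def Let_def)
    have "fst (run_delta k x) \<in> controls c"
      using k run_delta_closed[of k c "[]" x] by (auto simp: controls_def Let_def)
    moreover have "snd (run_delta k x) \<in> cells m"
      using assms by (cases "(k, x)" rule: run_delta.cases) (auto simp: cells_def)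
    ultimately show ?thesis using Run by (auto split: prod.splits)
  next
    case (Fwd k r)
    then have k: "k \<in> insert [] (conts c [])" using assms by (auto simp: controls_def Let_def)
    show ?thesis using Fwd assms k cmd_cell_bound[of x "hd k" r]
      by (auto simp: controls_def Let_def cells_def split: prod.splits)
  next
    case (Bwd k r)
    then have k: "k \<in> insert [] (conts c [])" using assms by (auto simp: controls_def Let_def)
    then have "next_conts k r \<in> insert [] (conts c [])"
      using next_conts_closed[of k c "[]" r] by auto
    then show ?thesis using Bwd assms k by (auto simp: controls_def Let_def)
  qed
  then show "fst (delta m c q x) \<in> controls c" "fst (snd (delta m c q x)) \<in> cells m" by auto
qed

text \<open>Pebble-free cells are coded by their base symbol, so that input and output need no translation.\<close>

definition code_cell :: "cell \<Rightarrow> nat" where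
  "code_cell x = fst x + 7 * set_encode (snd x)"

definition decode_cell :: "nat \<Rightarrow> cell" where
  "decode_cell k = (k mod 7, set_decode (k div 7))"

lemma decode_code_cell: "x \<in> cells m \<Longrightarrow> decode_cell (code_cell x) = x"
  by (auto simp: cells_def code_cell_def decode_cell_def finite_subset)

lemma set_encode_less: "M \<subseteq> {..<m} \<Longrightarrow> set_encode M < 2 ^ m"
proof -
  assume "M \<subseteq> {..<m}"
  then have "set_encode M \<le> (\<Sum>i\<in>{..<m}. 2 ^ i)"
    unfolding set_encode_def by (intro sum_mono2) auto
  also have "\<dots> < 2 ^ m" by (induction m) auto
  finally show ?thesis .
qed

lemma code_cell_less: "x \<in> cells m \<Longrightarrow> code_cell x < 7 * 2 ^ m"
  using set_encode_less[of "snd x" m] by (auto simp: cells_def code_cell_def)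

lemma decode_cell_cells: "k < 7 * 2 ^ m \<Longrightarrow> decode_cell k \<in> cells m"
proof -
  assume "k < 7 * 2 ^ m"
  then have k: "k div 7 < 2 ^ m" by (simp add: less_mult_imp_div_less mult.commute)
  have "i < m" if "i \<in> set_decode (k div 7)" for i
  proof (rule ccontr)
    assume "\<not> i < m"
    then have "k div 7 < 2 ^ i"
      using k power_increasing[of m i "2::nat"] by linarith
    then show False using that by (simp add: set_decode_def)
  qed
  then show ?thesis by (auto simp: decode_cell_def cells_def)
qed

section \<open>Numbering the states and transfer to a Turing machine\<close>

lemma enumerate_controls:
  "\<exists>e :: nat \<Rightarrow> control. \<exists>n\<ge>2. bij_betw e {..<n} (controls c) \<and> e 0 = Start \<and> e 1 = Halt"
proof -
  obtain xs where xs: "set xs = controls c - {Start, Halt}" "distinct xs"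
    using finite_distinct_list[of "controls c - {Start, Halt}"] finite_controls[of c] by blast
  let ?ys = "Start # Halt # xs"
  have "set ?ys = controls c" using xs by (auto simp: controls_def Let_def)
  moreover have "distinct ?ys" using xs by auto
  ultimately have "bij_betw (\<lambda>i. ?ys ! i) {..<length ?ys} (controls c)"
    by (intro bij_betw_nth) auto
  then show ?thesis by (intro exI[of _ "\<lambda>i. ?ys ! i"] exI[of _ "length ?ys"]) auto
qed

definition image_config :: "(control \<Rightarrow> nat) \<Rightarrow> control \<times> cell list \<times> cell list \<Rightarrow> config" where
  "image_config f = (\<lambda>(q, ls, rs). (f q, map code_cell ls, map code_cell rs))"

definition ok_config :: "nat \<Rightarrow> cmd \<Rightarrow> control \<times> cell list \<times> cell list \<Rightarrow> bool" where
  "ok_config m c = (\<lambda>(q, ls, rs). q \<in> controls c \<and> set ls \<subseteq> cells m \<and> set rs \<subseteq> cells m)"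

text \<open>Runs agree because the coding is injective on \<open>controls c\<close> and
  \<open>cells m\<close>, which \<open>delta_closed\<close> keeps invariant; as only
  \<open>Halt\<close> has number 1, both machines stop together.\<close>

lemma machine_exists:
  assumes "0 < m"
  shows "\<exists>M f. wf_tm M \<and> f Start = 0 \<and> f Halt = 1 \<and>
    (\<forall>x t. ok_config m c x \<longrightarrow> (tm_step M ^^ t) (image_config f x) = image_config f ((astep m c ^^ t) x))"
proof -
  obtain e and n :: nat where n: "n \<ge> 2" and e: "bij_betw e {..<n} (controls c)" "e 0 = Start" "e 1 = Halt"
    using enumerate_controls by blast
  define f where "f = the_inv_into {..<n} e"
  have inj: "inj_on e {..<n}" and img: "e ` {..<n} = controls c"
    using e(1) by (auto simp: bij_betw_def)
  have f: "f q < n" "e (f q) = q" if "q \<in> controls c" for q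
    using that inj img the_inv_into_into[of e "{..<n}" q "{..<n}"] f_the_inv_into_f[of e "{..<n}" q]
    by (auto simp: f_def)
  have f_e: "f (e i) = i" if "i < n" for i
    using that inj by (simp add: f_def the_inv_into_f_f)
  define D where "D = (\<lambda>q s. case delta m c (e q) (decode_cell s) of (q', y, d) \<Rightarrow> (f q', code_cell y, d))"
  define M where "M = \<lparr>tm_states = n, tm_syms = 7 * 2 ^ m, tm_delta = D\<rparr>"
  have wf: "wf_tm M"
    unfolding wf_tm_def
  proof (intro conjI allI impI)
    show "2 \<le> tm_states M" "7 \<le> tm_syms M" using n by (auto simp: M_def)
    fix q s assume "q < tm_states M" "s < tm_syms M"
    then have "e q \<in> controls c" "decode_cell s \<in> cells m"
      using img by (auto simp: M_def decode_cell_cells)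
    from delta_closed[OF assms this] show "case tm_delta M q s of (q', s', d) \<Rightarrow> q' < tm_states M \<and> s' < tm_syms M"
      by (auto simp: M_def D_def f code_cell_less split: prod.splits)
  qed
  \<comment> \<open>Reading past the end of the list yields the same symbol in both
    machines.\<close>
  have code_blank: "code_cell blank = 0" by (simp add: code_cell_def)
  have D: "D (f q) (code_cell x) = (case delta m c q x of (q', y, d) \<Rightarrow> (f q', code_cell y, d))"
    if "q \<in> controls c" "x \<in> cells m" for q x
    using that by (simp add: D_def f decode_code_cell)
  have fh: "f q = 1 \<longleftrightarrow> q = Halt" if "q \<in> controls c" for q
    using that f f_e[of 1] e n by force
  have step: "tm_step M (image_config f x) = image_config f (astep m c x) \<and> ok_config m c (astep m c x)"
    if ok: "ok_config m c x" for x
  proof (cases x)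
    case (fields q ls rs)
    define y where "y = (case rs of [] \<Rightarrow> blank | x # _ \<Rightarrow> x)"
    have q: "q \<in> controls c" "set ls \<subseteq> cells m" "set rs \<subseteq> cells m"
      using ok fields by (auto simp: ok_config_def)
    have y: "y \<in> cells m" using q by (auto simp: y_def cells_def split: list.splits)
    have cy: "(case map code_cell rs of [] \<Rightarrow> 0 | x # _ \<Rightarrow> x) = code_cell y"
      by (auto simp: y_def code_blank split: list.splits)
    have tl: "set (tl rs) \<subseteq> cells m" using q(3) by (cases rs) auto
    show ?thesis
    proof (cases "q = Halt")
      case True
      then show ?thesis using ok fields fh[OF q(1)] by (simp add: image_config_def)
    next
      case False
      obtain q' z d where qz: "delta m c q y = (q', z, d)" by (cases "delta m c q y")
      have "q' \<in> controls c" "z \<in> cells m" using delta_closed[OF assms q(1) y] qz by auto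
      then show ?thesis
        using False q tl fh[OF q(1)] qz D[OF q(1) y]
        unfolding fields image_config_def ok_config_def
        by (cases d) (auto simp: cy M_def Let_def y_def[symmetric] map_tl split: list.splits)
    qed
  qed
  have "(tm_step M ^^ t) (image_config f x) = image_config f ((astep m c ^^ t) x)
      \<and> ok_config m c ((astep m c ^^ t) x)" if "ok_config m c x" for x t
    using that by (induction t) (auto simp: step simp del: astep.simps tm_step.simps)
  moreover have "f Start = 0" "f Halt = 1" using f_e[of 0] f_e[of 1] e n by auto
  ultimately show ?thesis using wf by blast
qed

text \<open>\<open>Clear\<close> is appended so that no pebble remains on the output. The extra
  \<open>2 * length w + 5\<close> pays for marking the left end, sequencing, the sweep of
  \<open>Clear\<close> and halting.\<close>

lemma computes_exec:
  assumes c: "0 \<notin> mods c" "wf_cmd c"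
  shows "\<exists>M. wf_tm M \<and> (\<forall>w. w \<noteq> [] \<and> set w \<subseteq> {1..6} \<longrightarrow>
    (\<exists>t \<le> time c (length w) + 2 * length w + 5.
       tm_computes_within M t w (fst (exec c (w, \<lambda>v. if v = 0 then 0 else length w)))))"
proof -
  let ?c = "Seq c (Op Clear)"
  have "finite (insert 0 (vars c))" by (simp add: finite_vars)
  then obtain m where "\<forall>v\<in>insert 0 (vars c). v < m" unfolding finite_nat_set_iff_bounded by blast
  then have m: "insert 0 (vars c) \<subseteq> {..<m}" by blast
  then have m0: "0 < m" by auto
  obtain M f where M: "wf_tm M" "f Start = 0" "f Halt = 1"
    "\<And>x t. ok_config m ?c x \<Longrightarrow> (tm_step M ^^ t) (image_config f x) = image_config f ((astep m ?c ^^ t) x)"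
    using machine_exists[OF m0, of ?c] by blast
  show ?thesis
  proof (intro exI[of _ M] conjI allI impI, fact M(1))
    fix w assume "w \<noteq> [] \<and> set w \<subseteq> {1..6::nat}"
    then have w: "w \<noteq> []" "set w \<subseteq> {1..6}" by auto
    define s where "s = (w, \<lambda>v::nat. if v = 0 then 0 else length w)"
    define w' where "w' = fst (exec c s)"
    let ?raw = "\<lambda>b::nat. (b, {}::nat set)"
    have ok: "ok_store s" using w by (auto simp: ok_store_def s_def)
    have w': "length w' = length w" "w' \<noteq> []" "0 \<notin> set w'"
      using ok_exec[OF ok c(1)] length_exec[of c s] by (auto simp: w'_def ok_store_def s_def)
    have tape_s: "tape m (u, \<lambda>v. if v = 0 then 0 else length u) = (u ! 0, {0}) # map ?raw (tl u)"
      if "u \<noteq> []" for u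
      using that m0 by (intro nth_equalityI) (auto simp: tape_def cell_at_def nth_tl nth_Cons split: nat.split)
    have "tape m s = (w ! 0, {0}) # map ?raw (tl w)" unfolding s_def using tape_s w(1) by blast
    then have first: "reach m ?c 1 (Start, [], map ?raw w) (Run [?c], [], tape m s @ replicate 0 blank)"
      using w by (intro reach_step) (cases w; simp)
    have "simulated m ?c (time ?c (length w)) [?c] [] s (exec ?c s)"
      using simulated_exec[OF m0, of ?c s ?c "[]"] m c ok by (simp add: s_def)
    then obtain e where e: "reach m ?c (time ?c (length w)) (Run [?c], [], tape m s @ replicate 0 blank)
       (Run [], [], tape m (exec ?c s) @ replicate e blank)"
      unfolding simulated_def by blast
    have "exec ?c s = (w', \<lambda>v. if v = 0 then 0 else length w')"
      unfolding w'_def exec.simps act_Clear by (rule refl)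
    with tape_s[OF w'(2)] have "tape m (exec ?c s) = (w' ! 0, {0}) # map ?raw (tl w')" by metis
    then have last: "reach m ?c 1 (Run [], [], tape m (exec ?c s) @ replicate e blank)
       (Halt, [], map ?raw w' @ replicate e blank)"
      using w' by (intro reach_step) (cases w'; simp)
    have "reach m ?c (1 + time ?c (length w) + 1) (Start, [], map ?raw w) (Halt, [], map ?raw w' @ replicate e blank)"
      using first e last by (blast intro: reach_trans)
    then obtain t where t: "t \<le> 1 + time ?c (length w) + 1"
      "(astep m ?c ^^ t) (Start, [], map ?raw w) = (Halt, [], map ?raw w' @ replicate e blank)"
      unfolding reach_def by blast
    have raw: "map code_cell (map ?raw v) = v" for v
      by (simp add: code_cell_def o_def)
    have "ok_config m ?c (Start, [], map ?raw w)"
      using w by (auto simp: ok_config_def controls_def Let_def cells_def)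
    from M(4)[OF this, of t] have "tm_run M t w = (1, [], w' @ replicate e 0)"
      unfolding tm_run_def t(2) using M(2,3) by (simp add: image_config_def raw[simplified] code_cell_def)
    moreover have "takeWhile (\<lambda>s. s \<noteq> 0) (w' @ replicate e 0) = w'"
      using w'(3) by (subst takeWhile_append2) (auto simp: takeWhile_replicate intro: gr0I)
    ultimately have "tm_computes_within M t w w'"
      by (simp add: tm_computes_within_def)
    then show "\<exists>t \<le> time c (length w) + 2 * length w + 5.
       tm_computes_within M t w (fst (exec c (w, \<lambda>v. if v = 0 then 0 else length w)))"
      using t(1) unfolding w'_def s_def by (intro exI[of _ t]) auto
  qed
qed

subsection \<open>The limit by chaotic iteration\<close>

text \<open>A four-valued truth value is handled as the pair of bits \<open>supports True\<close>, \<open>supports False\<close>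
  (evidence for and against); then \<open>leq_p\<close> is inclusion and every connective is two-valued in each bit.\<close>

definition supports :: "bool \<Rightarrow> tv \<Rightarrow> bool" where
  "supports b v \<longleftrightarrow> leq_p (if b then Tt else Ff) v"

lemma supports_simps [simp]:
  "supports True v \<longleftrightarrow> v = Tt \<or> v = Ii" "supports False v \<longleftrightarrow> v = Ff \<or> v = Ii"
  by (auto simp: supports_def leq_p_def)

lemma leq_p_supports: "leq_p a b \<longleftrightarrow> (\<forall>c. supports c a \<longrightarrow> supports c b)"
  by (cases a; cases b) (auto simp: leq_p_def all_bool_eq)

lemma supports_code: "supports b v \<longleftrightarrow> code_tv v \<in> {if b then 3 else 4, 6}"
  by (cases v; cases b) (auto simp: code_tv_def)

lemma supports_inv: "supports b (inv_tv v) \<longleftrightarrow> supports (\<not> b) v"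
  by (cases v; cases b) (auto simp: inv_tv_def)

lemma leq_p_antisym: "leq_p a b \<Longrightarrow> leq_p b a \<Longrightarrow> a = b"
  by (cases a; cases b) (auto simp: leq_p_def)

lemma leq_t_antisym: "leq_t a b \<Longrightarrow> leq_t b a \<Longrightarrow> a = b"
  by (cases a; cases b) (auto simp: leq_t_def)

lemma all_tv: "(\<forall>v. P v) \<longleftrightarrow> P Tt \<and> P Ff \<and> P Uu \<and> P Ii"
  by (metis tv.exhaust)

lemma ex_tv: "(\<exists>v. P v) \<longleftrightarrow> P Tt \<or> P Ff \<or> P Uu \<or> P Ii"
  by (metis tv.exhaust)

text \<open>The truth order is a diamond in which \<open>Uu\<close> and \<open>Ii\<close> are
  incomparable, so together they meet in \<open>Ff\<close>. The empty set yields \<open>Tt\<close>,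
  which matters for quantifiers over the empty domain.\<close>

lemma glb_t_eq: "glb_t S = (if Ff \<in> S \<or> (Uu \<in> S \<and> Ii \<in> S) then Ff
    else if Uu \<in> S then Uu else if Ii \<in> S then Ii else Tt)" (is "_ = ?g")
  unfolding glb_t_def
proof (rule the_equality)
  show g: "(\<forall>x\<in>S. leq_t ?g x) \<and> (\<forall>h. (\<forall>x\<in>S. leq_t h x) \<longrightarrow> leq_t h ?g)"
    by (auto simp: leq_t_def Ball_def all_tv)
  fix g assume "(\<forall>x\<in>S. leq_t g x) \<and> (\<forall>h. (\<forall>x\<in>S. leq_t h x) \<longrightarrow> leq_t h g)"
  with g have "leq_t g ?g" "leq_t ?g g" by auto
  then show "g = ?g" by (rule leq_t_antisym)
qed

lemma lub_t_eq: "lub_t S = (if Tt \<in> S \<or> (Uu \<in> S \<and> Ii \<in> S) then Tt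
    else if Uu \<in> S then Uu else if Ii \<in> S then Ii else Ff)" (is "_ = ?g")
  unfolding lub_t_def
proof (rule the_equality)
  show g: "(\<forall>x\<in>S. leq_t x ?g) \<and> (\<forall>h. (\<forall>x\<in>S. leq_t x h) \<longrightarrow> leq_t ?g h)"
    by (auto simp: leq_t_def Ball_def all_tv)
  fix g assume "(\<forall>x\<in>S. leq_t x g) \<and> (\<forall>h. (\<forall>x\<in>S. leq_t x h) \<longrightarrow> leq_t g h)"
  with g have "leq_t g ?g" "leq_t ?g g" by auto
  then show "g = ?g" by (rule leq_t_antisym)
qed

text \<open>\<open>leq_t\<close> means more evidence for and less against, so a meet intersects the
  first bit and unites the second.\<close>

lemma supports_glb: "supports b (glb_t S) \<longleftrightarrow> (if b then \<forall>x\<in>S. supports b x else \<exists>x\<in>S. supports b x)"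
  unfolding glb_t_eq by (cases b) (auto simp: Ball_def Bex_def all_tv ex_tv)

lemma supports_lub: "supports b (lub_t S) \<longleftrightarrow> (if b then \<exists>x\<in>S. supports b x else \<forall>x\<in>S. supports b x)"
  unfolding lub_t_eq by (cases b) (auto simp: Ball_def Bex_def all_tv ex_tv)

lemma lub_p_eq: "lub_p {if b then Tt else Ff, v} = (if v = Uu \<or> v = (if b then Tt else Ff) then (if b then Tt else Ff) else Ii)"
  (is "_ = ?g")
  unfolding lub_p_def
proof (rule the_equality)
  show g: "(\<forall>x\<in>{if b then Tt else Ff, v}. leq_p x ?g) \<and>
      (\<forall>h. (\<forall>x\<in>{if b then Tt else Ff, v}. leq_p x h) \<longrightarrow> leq_p ?g h)"
    by (cases v; cases b) (auto simp: leq_p_def)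
  fix g assume "(\<forall>x\<in>{if b then Tt else Ff, v}. leq_p x g) \<and>
      (\<forall>h. (\<forall>x\<in>{if b then Tt else Ff, v}. leq_p x h) \<longrightarrow> leq_p g h)"
  with g have "leq_p g ?g" "leq_p ?g g" by blast+
  then show "g = ?g" by (rule leq_p_antisym)
qed

lemma code_lub_p: "code_tv (lub_p {if b then Tt else Ff, v}) = join_code b (code_tv v)"
  unfolding lub_p_eq by (cases v; cases b) (auto simp: code_tv_def join_code_def)

lemma supports_lub_p: "supports c (lub_p {if b then Tt else Ff, v}) \<longleftrightarrow> c = b \<or> supports c v"
  unfolding lub_p_eq by (cases v; cases b; cases c) auto

lemmas supports_lub_p' = supports_lub_p[of _ True, unfolded if_True] supports_lub_p[of _ False, unfolded if_False]

lemma struct_refl: "leq_p_struct J J"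
  by (simp add: leq_p_struct_def leq_p_def)

lemma struct_trans: "leq_p_struct J K \<Longrightarrow> leq_p_struct K L \<Longrightarrow> leq_p_struct J L"
  by (simp add: leq_p_struct_def leq_p_supports)

lemma struct_antisym: "leq_p_struct J K \<Longrightarrow> leq_p_struct K J \<Longrightarrow> J = K"
  by (intro ext) (simp add: leq_p_struct_def leq_p_antisym)

text \<open>No connective asks for the absence of evidence. Both bits are treated together, since
  \<open>Neg\<close> exchanges them.\<close>

lemma eval_mono:
  assumes "leq_p_struct J K"
  shows "supports b (eval n J \<theta> f) \<Longrightarrow> supports b (eval n K \<theta> f)"
proof (induction f arbitrary: b \<theta>)
  case (Atom P xs)
  then show ?case using assms by (simp add: leq_p_struct_def leq_p_supports)
next
  case (Neg f)
  then show ?case by (simp add: supports_inv del: supports_simps)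
next
  case (Conj f g)
  then show ?case by (auto simp: supports_glb simp del: supports_simps split: if_splits)
next
  case (Disj f g)
  then show ?case by (auto simp: supports_lub simp del: supports_simps split: if_splits)
next
  case (All x f)
  then show ?case by (fastforce simp: supports_glb simp del: supports_simps split: if_splits)
next
  case (Ex x f)
  then show ?case by (fastforce simp: supports_lub simp del: supports_simps split: if_splits)
qed auto

section \<open>Table entries and the precision measure\<close>

definition entries :: "'p list \<Rightarrow> ('p \<Rightarrow> nat) \<Rightarrow> nat \<Rightarrow> ('p \<times> nat list) list" where
  "entries sig ar n = concat (map (\<lambda>P. map (Pair P) (product_lists (replicate (ar P) [0..<n]))) sig)"

lemma encode_entries:
  "encode sig ar n J = replicate n 1 @ 2 # map (\<lambda>(P, ds). code_tv (J P ds)) (entries sig ar n)"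
  by (simp add: encode_def entries_def map_concat o_def)

lemma length_encode: "length (encode sig ar n J) = n + 1 + length (entries sig ar n)"
  by (simp add: encode_entries)

lemma set_tuples: "set (product_lists (replicate r [0..<n])) = {ds. length ds = r \<and> set ds \<subseteq> {..<n}}"
proof (induction r)
  case (Suc r)
  have "{ds. length ds = Suc r \<and> set ds \<subseteq> {..<n}} =
      (\<Union>i<n. (#) i ` {ds. length ds = r \<and> set ds \<subseteq> {..<n}})"
    by (auto simp: length_Suc_conv image_iff)
  then show ?case using Suc by (auto simp: atLeast0LessThan)
qed auto

lemma set_entries:
  "set (entries sig ar n) = {(P, ds). P \<in> set sig \<and> length ds = ar P \<and> set ds \<subseteq> {..<n}}"
  by (auto simp: entries_def set_tuples)

lemma wf_struct_entries: "wf_struct sig ar n J \<Longrightarrow> (P, ds) \<notin> set (entries sig ar n) \<Longrightarrow> J P ds = Uu"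
  by (simp add: wf_struct_def set_entries)

lemma distinct_entries: "distinct sig \<Longrightarrow> distinct (entries sig ar n)"
proof -
  have "distinct (product_lists (replicate r [0..<n]))" for r
    by (intro distinct_product_lists) auto
  then show "distinct sig \<Longrightarrow> distinct (entries sig ar n)"
    unfolding entries_def
    by (induction sig) (auto simp: distinct_map inj_on_def)
qed

lemma length_tuples: "length (product_lists (replicate r [0..<n])) = n ^ r"
  by (induction r) (simp_all add: length_concat o_def sum_list_triv)

lemma length_entries: "length (entries sig ar n) = (\<Sum>P\<leftarrow>sig. n ^ ar P)"
  by (simp add: entries_def length_concat o_def length_tuples)

text \<open>The number of bits that the value supports, which is its height in the precision
  order.\<close>

definition rank :: "tv \<Rightarrow> nat" where
  "rank v = (case v of Uu \<Rightarrow> 0 | Ii \<Rightarrow> 2 | _ \<Rightarrow> 1)"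

lemma rank_le: "leq_p a b \<Longrightarrow> rank a \<le> rank b"
  by (cases a; cases b) (auto simp: leq_p_def rank_def)

lemma rank_less: "leq_p a b \<Longrightarrow> a \<noteq> b \<Longrightarrow> rank a < rank b"
  by (cases a; cases b) (auto simp: leq_p_def rank_def)

definition precision :: "'p list \<Rightarrow> ('p \<Rightarrow> nat) \<Rightarrow> nat \<Rightarrow> 'p interp \<Rightarrow> nat" where
  "precision sig ar n J = (\<Sum>(P, ds)\<in>set (entries sig ar n). rank (J P ds))"

lemma precision_bound: "precision sig ar n J \<le> 2 * length (entries sig ar n)"
proof -
  have "precision sig ar n J \<le> (\<Sum>x\<in>set (entries sig ar n). 2)"
    unfolding precision_def by (intro sum_mono) (auto simp: rank_def split: tv.splits)
  also have "\<dots> \<le> 2 * length (entries sig ar n)" by (simp add: card_length)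
  finally show ?thesis .
qed

lemma precision_less:
  assumes "leq_p_struct J K" "J \<noteq> K" "wf_struct sig ar n J" "wf_struct sig ar n K"
  shows "precision sig ar n J < precision sig ar n K"
proof -
  obtain P ds where ne: "J P ds \<noteq> K P ds" using assms(2) by (meson ext)
  \<comment> \<open>Outside the entries both structures are normalised to \<open>Uu\<close>, so the
    difference is seen by the finite sum.\<close>
  have "(P, ds) \<in> set (entries sig ar n)"
    using ne wf_struct_entries[OF assms(3)] wf_struct_entries[OF assms(4)] by metis
  moreover have "rank (J P ds) < rank (K P ds)"
    using ne assms(1) by (auto intro: rank_less simp: leq_p_struct_def)
  ultimately show ?thesis
    unfolding precision_def using assms(1)
    by (intro sum_strict_mono_ex1) (auto simp: leq_p_struct_def intro!: rank_le bexI[of _ "(P, ds)"])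
qed

section \<open>Propagators and the limit as least common fixed point\<close>

lemma supports_INF_prop: "supports c (INF_prop n \<phi> J P ds) \<longleftrightarrow> supports c (J P ds) \<or>
    c = inf_pos \<phi> \<and> P = inf_pred \<phi> \<and> length ds = length (inf_vars \<phi>) \<and> set ds \<subseteq> {..<n} \<and>
    supports True (eval n J (assign (inf_vars \<phi>) ds) (inf_body \<phi>))"
  unfolding INF_prop_def supports_def[of True] if_True
  by (auto simp: supports_lub_p' simp del: supports_simps)

lemma INF_prop_inflationary: "leq_p_struct J (INF_prop n \<phi> J)"
  by (simp add: leq_p_struct_def leq_p_supports supports_INF_prop del: supports_simps)

lemma INF_prop_mono: "leq_p_struct J K \<Longrightarrow> leq_p_struct (INF_prop n \<phi> J) (INF_prop n \<phi> K)"
  using eval_mono[of J K True]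
  by (auto simp: leq_p_struct_def leq_p_supports supports_INF_prop simp del: supports_simps)

lemma INF_prop_wf:
  "is_INF sig ar \<phi> \<Longrightarrow> wf_struct sig ar n J \<Longrightarrow> wf_struct sig ar n (INF_prop n \<phi> J)"
  by (auto simp: wf_struct_def INF_prop_def is_INF_def)

text \<open>Needed because \<open>lim\<close> is a definite description. One strict step is put in
  front of a sequence for the more precise structure; the bound on \<open>precision\<close> makes
  this terminate.\<close>

lemma stabilizing_exists:
  assumes "\<forall>\<phi>\<in>V. is_INF sig ar \<phi>" "wf_struct sig ar n J"
  shows "\<exists>js. stabilizing_seq ((\<lambda>\<phi>. INF_prop n \<phi>) ` V) J js"
  using assms(2)
proof (induction "2 * length (entries sig ar n) - precision sig ar n J" arbitrary: J rule: less_induct)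
  case less
  let ?W = "(\<lambda>\<phi>. INF_prop n \<phi>) ` V"
  show ?case
  proof (cases "\<forall>Op\<in>?W. Op J = J")
    case True
    then show ?thesis
      by (intro exI[of _ "[J]"]) (auto simp: stabilizing_seq_def refinement_seq_def)
  next
    case False
    then obtain \<phi> where \<phi>: "\<phi> \<in> V" "INF_prop n \<phi> J \<noteq> J" by auto
    let ?K = "INF_prop n \<phi> J"
    have K: "wf_struct sig ar n ?K" using \<phi> assms(1) less.prems by (auto intro: INF_prop_wf)
    have le: "leq_p_struct J ?K" by (rule INF_prop_inflationary)
    have "precision sig ar n J < precision sig ar n ?K"
      using precision_less[OF le _ less.prems K] \<phi> by auto
    then obtain js where js: "stabilizing_seq ?W ?K js"
      using less.hyps[OF _ K] precision_bound[of sig ar n ?K] by fastforce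
    have "refinement_seq ?W J (J # js)"
      unfolding refinement_seq_def
    proof (intro conjI allI impI)
      fix k assume k: "Suc k < length (J # js)"
      show "\<exists>Op\<in>?W. (J # js) ! Suc k = Op ((J # js) ! k)"
        using js k \<phi> by (cases k) (auto simp: stabilizing_seq_def refinement_seq_def)
      show "lt_p_struct ((J # js) ! k) ((J # js) ! Suc k)"
        using js k \<phi> le by (cases k) (auto simp: stabilizing_seq_def refinement_seq_def lt_p_struct_def)
    qed auto
    then have "stabilizing_seq ?W J (J # js)"
      using js by (auto simp: stabilizing_seq_def refinement_seq_def)
    then show ?thesis by blast
  qed
qed

text \<open>Inflation keeps the sequence above \<open>J\<close>; monotonicity keeps it below
  \<open>K\<close>, because a propagator maps a structure below \<open>K\<close> to one below its
  value at \<open>K\<close>, which is \<open>K\<close>.\<close>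

lemma refinement_seq_bounds:
  assumes "refinement_seq ((\<lambda>\<phi>. INF_prop n \<phi>) ` V) J js"
  shows "k < length js \<Longrightarrow> leq_p_struct J (js ! k) \<and>
    (\<forall>K. leq_p_struct J K \<and> (\<forall>\<phi>\<in>V. INF_prop n \<phi> K = K) \<longrightarrow> leq_p_struct (js ! k) K)"
proof (induction k)
  case 0
  then show ?case using assms by (auto simp: refinement_seq_def struct_refl)
next
  case (Suc k)
  then obtain \<phi> where \<phi>: "\<phi> \<in> V" "js ! Suc k = INF_prop n \<phi> (js ! k)"
    using assms by (auto simp: refinement_seq_def)
  then show ?case
    using Suc INF_prop_inflationary[of "js ! k" n \<phi>] INF_prop_mono[of "js ! k" _ n \<phi>]
      struct_trans by (metis Suc_lessD)
qed

text \<open>The last element of any stabilizing sequence is a common fixed point above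
  \<open>J\<close> and lies below all of them. This gives uniqueness without a confluence
  argument.\<close>

lemma lim_eqI:
  assumes "\<forall>\<phi>\<in>V. is_INF sig ar \<phi>" "wf_struct sig ar n J"
    and K: "leq_p_struct J K" "\<forall>\<phi>\<in>V. INF_prop n \<phi> K = K"
      "\<And>K'. leq_p_struct J K' \<Longrightarrow> \<forall>\<phi>\<in>V. INF_prop n \<phi> K' = K' \<Longrightarrow> leq_p_struct K K'"
  shows "lim ((\<lambda>\<phi>. INF_prop n \<phi>) ` V) J = K"
proof -
  let ?W = "(\<lambda>\<phi>. INF_prop n \<phi>) ` V"
  have last: "last js = K" if js: "stabilizing_seq ?W J js" for js
  proof -
    have r: "refinement_seq ?W J js" and ne: "js \<noteq> []" and fp: "\<forall>\<phi>\<in>V. INF_prop n \<phi> (last js) = last js"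
      using js by (auto simp: stabilizing_seq_def refinement_seq_def)
    have "leq_p_struct J (last js)" "leq_p_struct (last js) K"
      using refinement_seq_bounds[OF r, of "length js - 1"] ne K by (auto simp: last_conv_nth)
    with K(3)[OF _ fp] show ?thesis by (intro struct_antisym)
  qed
  moreover obtain js where "stabilizing_seq ?W J js" using stabilizing_exists[OF assms(1,2)] by blast
  ultimately show ?thesis unfolding lim_def by (intro the_equality) auto
qed

text \<open>Applying propagators in place, one tuple at a time, need not follow a refinement sequence,
  but it stays between the start structure and every common fixed point above it.\<close>

definition update :: "nat \<Rightarrow> 'p inf_sentence \<Rightarrow> 'p \<times> nat list \<Rightarrow> 'p interp \<Rightarrow> 'p interp" where
  "update n \<phi> = (\<lambda>(P, ds) J.
     if P = inf_pred \<phi> \<and> supports True (eval n J (assign (inf_vars \<phi>) ds) (inf_body \<phi>))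
     then J(P := (J P)(ds := lub_p {if inf_pos \<phi> then Tt else Ff, J P ds})) else J)"

definition updates :: "'p list \<Rightarrow> ('p \<Rightarrow> nat) \<Rightarrow> nat \<Rightarrow> 'p inf_sentence list \<Rightarrow> ('p inf_sentence \<times> 'p \<times> nat list) list" where
  "updates sig ar n \<phi>s = concat (map (\<lambda>\<phi>. map (Pair \<phi>) (entries sig ar n)) \<phi>s)"

definition pass :: "'p list \<Rightarrow> ('p \<Rightarrow> nat) \<Rightarrow> nat \<Rightarrow> 'p inf_sentence list \<Rightarrow> 'p interp \<Rightarrow> 'p interp" where
  "pass sig ar n \<phi>s = fold (\<lambda>\<phi>. fold (update n \<phi>) (entries sig ar n)) \<phi>s"

lemma pass_updates: "pass sig ar n \<phi>s J = fold (\<lambda>(\<phi>, e). update n \<phi> e) (updates sig ar n \<phi>s) J"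
  unfolding pass_def updates_def
  by (induction \<phi>s arbitrary: J) (auto simp: fold_map o_def)

lemma supports_update: "supports c (update n \<phi> (Q, es) J P ds) \<longleftrightarrow> supports c (J P ds) \<or>
    c = inf_pos \<phi> \<and> P = Q \<and> ds = es \<and> Q = inf_pred \<phi> \<and>
    supports True (eval n J (assign (inf_vars \<phi>) ds) (inf_body \<phi>))"
  unfolding update_def
  by (auto simp: supports_lub_p' simp del: supports_simps)

lemma update_inflationary: "leq_p_struct J (update n \<phi> e J)"
  by (cases e) (simp add: leq_p_struct_def leq_p_supports supports_update del: supports_simps)

lemma update_wf:
  "e \<in> set (entries sig ar n) \<Longrightarrow> wf_struct sig ar n J \<Longrightarrow> wf_struct sig ar n (update n \<phi> e J)"
  by (cases e) (auto simp: wf_struct_def update_def set_entries)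

text \<open>The updated entry is one of those that the propagator raises at once, so a fixed point
  of the propagator also bounds in-place updates.\<close>

lemma update_below_INF_prop:
  assumes "is_INF sig ar \<phi>" "e \<in> set (entries sig ar n)"
  shows "leq_p_struct (update n \<phi> e J) (INF_prop n \<phi> J)"
  using assms
  by (cases e) (auto simp: leq_p_struct_def leq_p_supports supports_update supports_INF_prop
      set_entries is_INF_def simp del: supports_simps)

lemma fixed_of_updates:
  assumes "is_INF sig ar \<phi>" "\<And>e. e \<in> set (entries sig ar n) \<Longrightarrow> update n \<phi> e J = J"
  shows "INF_prop n \<phi> J = J"
proof (intro ext)
  fix P ds
  show "INF_prop n \<phi> J P ds = J P ds"
  proof (cases "P = inf_pred \<phi> \<and> length ds = length (inf_vars \<phi>) \<and> set ds \<subseteq> {..<n}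
        \<and> leq_p Tt (eval n J (assign (inf_vars \<phi>) ds) (inf_body \<phi>))")
    case True
    then have "(P, ds) \<in> set (entries sig ar n)" using assms(1) by (auto simp: set_entries is_INF_def)
    from assms(2)[OF this] True have "J(P := (J P)(ds := lub_p {if inf_pos \<phi> then Tt else Ff, J P ds})) = J"
      by (simp add: update_def supports_def[of True] del: supports_simps)
    then have "lub_p {if inf_pos \<phi> then Tt else Ff, J P ds} = J P ds" by (metis fun_upd_same)
    then show ?thesis using True by (simp add: INF_prop_def)
  next
    case False
    then show ?thesis by (auto simp: INF_prop_def)
  qed
qed

lemma fold_inflationary:
  assumes "\<And>x J. leq_p_struct J (f x J)"
  shows "leq_p_struct J (fold f xs J)"
  by (induction xs arbitrary: J) (auto simp: struct_refl intro: struct_trans assms)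

text \<open>An increasing chain that returns to its start is constant. Hence a pass without net
  effect shows every single update to be ineffective.\<close>

lemma fold_fixed:
  assumes "\<And>x J. leq_p_struct J (f x J)" "fold f xs J = J" "x \<in> set xs"
  shows "f x J = J"
  using assms(2,3)
proof (induction xs)
  case (Cons y ys)
  have "leq_p_struct (f y J) J" using fold_inflationary[of f "f y J" ys] assms(1) Cons.prems by simp
  then have "f y J = J" using assms(1) struct_antisym by blast
  then show ?case using Cons by auto
qed simp

lemma pass_inflationary: "leq_p_struct J (pass sig ar n \<phi>s J)"
  unfolding pass_updates by (rule fold_inflationary) (auto intro: update_inflationary)

lemma pass_wf: "wf_struct sig ar n J \<Longrightarrow> wf_struct sig ar n (pass sig ar n \<phi>s J)"
proof -
  have "set es \<subseteq> set (updates sig ar n \<phi>s) \<Longrightarrow> wf_struct sig ar n J \<Longrightarrow>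
      wf_struct sig ar n (fold (\<lambda>(\<phi>, e). update n \<phi> e) es J)" for es
    by (induction es arbitrary: J) (auto simp: updates_def intro!: update_wf)
  then show "wf_struct sig ar n J \<Longrightarrow> wf_struct sig ar n (pass sig ar n \<phi>s J)"
    unfolding pass_updates by blast
qed

lemma pass_below:
  assumes "\<forall>\<phi>\<in>set \<phi>s. is_INF sig ar \<phi> \<and> INF_prop n \<phi> K = K" "leq_p_struct J K"
  shows "leq_p_struct (pass sig ar n \<phi>s J) K"
proof -
  have "set es \<subseteq> set (updates sig ar n \<phi>s) \<Longrightarrow> leq_p_struct J K \<Longrightarrow>
      leq_p_struct (fold (\<lambda>(\<phi>, e). update n \<phi> e) es J) K" for es
  proof (induction es arbitrary: J)
    case (Cons x es)
    obtain \<phi> e where x: "x = (\<phi>, e)" by (cases x)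
    with Cons.prems have \<phi>: "\<phi> \<in> set \<phi>s" "e \<in> set (entries sig ar n)" by (auto simp: updates_def)
    have "leq_p_struct (update n \<phi> e J) K"
      using update_below_INF_prop[OF _ \<phi>(2), of \<phi> J] INF_prop_mono[OF Cons.prems(2), of n \<phi>]
        assms(1) \<phi>(1) struct_trans by metis
    then show ?case using Cons x by simp
  qed simp
  then show ?thesis unfolding pass_updates using assms(2) by blast
qed

lemma pass_fixed:
  assumes "\<forall>\<phi>\<in>set \<phi>s. is_INF sig ar \<phi>" "pass sig ar n \<phi>s J = J" "\<phi> \<in> set \<phi>s"
  shows "INF_prop n \<phi> J = J"
proof (rule fixed_of_updates)
  fix e assume "e \<in> set (entries sig ar n)"
  then have "(\<phi>, e) \<in> set (updates sig ar n \<phi>s)" using assms(3) by (auto simp: updates_def)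
  from fold_fixed[OF _ assms(2)[unfolded pass_updates] this] show "update n \<phi> e J = J"
    by (auto simp: update_inflationary)
qed (use assms in auto)

lemma iterated_pass_lim:
  assumes V: "\<forall>\<phi>\<in>set \<phi>s. is_INF sig ar \<phi>" and J: "wf_struct sig ar n J"
    and m: "2 * length (entries sig ar n) < m"
  shows "(pass sig ar n \<phi>s ^^ m) J = lim ((\<lambda>\<phi>. INF_prop n \<phi>) ` set \<phi>s) J"
proof -
  let ?F = "pass sig ar n \<phi>s"
  have wf: "wf_struct sig ar n ((?F ^^ i) J)" for i
    by (induction i) (auto simp: J pass_wf)
  \<comment> \<open>A stable structure stays stable, so instability after \<open>i\<close> passes
    means that each of them was strict.\<close>
  have grow: "?F ((?F ^^ i) J) = (?F ^^ i) J \<or> i \<le> precision sig ar n ((?F ^^ i) J)" for i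
  proof (induction i)
    case (Suc i)
    show ?case
    proof (cases "?F ((?F ^^ i) J) = (?F ^^ i) J")
      case False
      then have "precision sig ar n ((?F ^^ i) J) < precision sig ar n ((?F ^^ Suc i) J)"
        using precision_less[OF pass_inflationary, of "(?F ^^ i) J" sig ar n \<phi>s] wf[of i] wf[of "Suc i"] by force
      then show ?thesis using Suc False by auto
    qed simp
  qed simp
  have "?F ((?F ^^ m) J) = (?F ^^ m) J"
    using grow[of m] m precision_bound[of sig ar n "(?F ^^ m) J"] by auto
  then have fixed: "\<forall>\<phi>\<in>set \<phi>s. INF_prop n \<phi> ((?F ^^ m) J) = (?F ^^ m) J"
    using pass_fixed[OF V] by blast
  have "leq_p_struct J ((?F ^^ i) J)" for i
    by (induction i) (auto simp: struct_refl intro: struct_trans pass_inflationary)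
  moreover have "leq_p_struct ((?F ^^ i) J) K"
    if "leq_p_struct J K" "\<forall>\<phi>\<in>set \<phi>s. INF_prop n \<phi> K = K" for K i
    using that V by (induction i) (auto intro: pass_below)
  ultimately show ?thesis
    using lim_eqI[OF V J _ fixed] by metis
qed

subsection \<open>Pebble programs for formulas and propagators\<close>

text \<open>All that loops over the domain need to know about the tape; changes to table cells
  preserve it.\<close>

definition domain_word :: "nat \<Rightarrow> nat list \<Rightarrow> bool" where
  "domain_word n w \<longleftrightarrow> (\<exists>v. w = replicate n 1 @ 2 # v)"

lemma domain_word_encode: "domain_word n (encode sig ar n J)"
  by (auto simp: domain_word_def encode_entries)

lemma domain_word_length: "domain_word n w \<Longrightarrow> n < length w"
  by (auto simp: domain_word_def)

lemma domain_word_nth: "domain_word n w \<Longrightarrow> i \<le> n \<Longrightarrow> w ! i \<in> {1} \<longleftrightarrow> i < n"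
  by (cases "i = n") (auto simp: domain_word_def nth_append)

section \<open>Invariant rules for loops over the domain and over tuples\<close>

lemma exec_While:
  assumes 0: "J 0 s"
    and test: "\<And>i s. J i s \<Longrightarrow> i \<le> m \<Longrightarrow> holds (Base v B) s \<longleftrightarrow> i < m"
    and step: "\<And>i s. J i s \<Longrightarrow> i < m \<Longrightarrow> J (Suc i) (act (Inc v) (exec c s))"
    and m: "m \<le> length (fst s)"
  shows "J m (exec (While v B c) s)"
proof -
  let ?f = "\<lambda>s. if holds (Base v B) s then act (Inc v) (exec c s) else s"
  \<comment> \<open>\<open>exec\<close> always iterates as often as the tape is long; rounds after
    the failed test do nothing, whence the \<open>min\<close>.\<close>
  have "J (min i m) ((?f ^^ i) s)" for i
  proof (induction i)
    case (Suc i)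
    show ?case
    proof (cases "i < m")
      case True
      then show ?thesis using test[OF Suc] step[OF Suc] by (simp del: holds.simps)
    next
      case False
      then have i: "min i m = m" "min (Suc i) m = m" by auto
      show ?thesis using test[OF Suc] Suc unfolding i by (simp del: holds.simps)
    qed
  qed (use 0 in simp)
  from this[of "length (fst s)"] show ?thesis using m by simp
qed

declare exec.simps(5) [simp del]

text \<open>The pebble runs over the ones, its position being the current domain element; the symbol
  2 on cell \<open>n\<close> ends the loop.\<close>

definition For :: "nat \<Rightarrow> cmd \<Rightarrow> cmd" where
  "For v c = Seq (Op (Copy v 0)) (While v {1} c)"

lemma exec_For:
  assumes v: "v \<notin> mods c" "0 \<notin> mods c" "v \<noteq> 0" and s: "snd s 0 = 0"
    and init: "J 0 (fst s, (snd s)(v := 0))"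
    and shape: "\<And>i s. J i s \<Longrightarrow> domain_word n (fst s)"
    and step: "\<And>i s. J i s \<Longrightarrow> i < n \<Longrightarrow> snd s v = i \<Longrightarrow> snd s 0 = 0 \<Longrightarrow>
      J (Suc i) (fst (exec c s), (snd (exec c s))(v := Suc i))"
  shows "J n (exec (For v c) s)"
proof -
  let ?J = "\<lambda>i s. J i s \<and> snd s v = i \<and> snd s 0 = 0"
  let ?s = "(fst s, (snd s)(v := 0))"
  have "?J n (exec (While v {1} c) ?s)"
  proof (rule exec_While[where J = ?J and m = n])
    show "?J 0 ?s" using init s v by simp
    show "holds (Base v {1}) s \<longleftrightarrow> i < n" if "?J i s" "i \<le> n" for i s
      using that shape[of i s] domain_word_nth[of n "fst s" i] domain_word_length[of n "fst s"]
      by (cases s) auto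
    show "?J (Suc i) (act (Inc v) (exec c s))" if "?J i s" "i < n" for i s
      using that step[of i s] exec_mods[of v c s] exec_zero[of c s] v by (cases "exec c s") auto
    show "n \<le> length (fst ?s)" using shape[OF init] domain_word_length[of n "fst s"] by simp
  qed
  moreover have "exec (For v c) s = exec (While v {1} c) ?s"
    using s by (cases s) (simp add: For_def)
  ultimately show ?thesis by simp
qed

lemma mods_For [simp]: "mods (For v c) = insert v (mods c)"
  by (simp add: For_def)

lemma wf_For [simp]: "wf_cmd (For v c) \<longleftrightarrow> v \<notin> mods c \<and> wf_cmd c"
  by (simp add: For_def)

fun loops :: "nat \<Rightarrow> nat \<Rightarrow> cmd \<Rightarrow> cmd" where
  "loops k 0 c = c"
| "loops k (Suc r) c = For k (loops (Suc k) r c)"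

lemma mods_loops [simp]: "mods (loops k r c) = {k..<k + r} \<union> mods c"
  by (induction r arbitrary: k) auto

lemma wf_loops: "wf_cmd c \<Longrightarrow> mods c \<inter> {k..<k + r} = {} \<Longrightarrow> wf_cmd (loops k r c)"
proof (induction r arbitrary: k)
  case (Suc r)
  then have "mods c \<inter> {Suc k..<Suc k + r} = {}" "k \<notin> mods c" by fastforce+
  then show ?case using Suc by simp
qed simp

text \<open>The invariant is indexed by the tuples already treated. \<open>pre\<close> holds the
  values of the outer loops, which lets the induction descend to the inner ones;
  \<open>frame\<close> lets loop pebbles move under the invariant.\<close>

lemma exec_loops:
  fixes J :: "nat list list \<Rightarrow> store \<Rightarrow> bool"
  assumes body: "\<And>done ds rest s. all = done @ ds # rest \<Longrightarrow> J done s \<Longrightarrow> snd s 0 = 0 \<Longrightarrow>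
      map (snd s) [k..<k + r0] = ds \<Longrightarrow> J (done @ [ds]) (exec c s)"
    and shape: "\<And>done s. J done s \<Longrightarrow> domain_word n (fst s)"
    and frame: "\<And>done w p v x. k \<le> v \<Longrightarrow> v < k + r0 \<Longrightarrow> J done (w, p) \<Longrightarrow> J done (w, p(v := x))"
    and mods: "mods c \<inter> {k..<k + r0} = {}" "0 \<notin> mods c" "0 < k"
  shows "all = done @ map ((@) pre) (product_lists (replicate r [0..<n])) @ rest \<Longrightarrow>
    length pre + r = r0 \<Longrightarrow> J done s \<Longrightarrow> snd s 0 = 0 \<Longrightarrow> map (snd s) [k..<k + length pre] = pre \<Longrightarrow>
    J (done @ map ((@) pre) (product_lists (replicate r [0..<n]))) (exec (loops (k + length pre) r c) s)"
proof (induction r arbitrary: pre "done" rest s)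
  case 0
  then show ?case using body[of "done" pre rest s] by simp
next
  case (Suc r)
  define Y where "Y i = map ((@) (pre @ [i])) (product_lists (replicate r [0..<n]))" for i
  let ?v = "k + length pre"
  let ?c = "loops (Suc ?v) r c"
  \<comment> \<open>The order is lexicographic: tuples extending \<open>pre\<close> come in
    consecutive blocks, one for each next component.\<close>
  have X: "map ((@) pre) (product_lists (replicate (Suc r) [0..<n])) = concat (map Y [0..<n])"
  proof -
    have "Y = (\<lambda>i. map (\<lambda>l. pre @ i # l) (product_lists (replicate r [0..<n])))"
      by (simp add: Y_def fun_eq_iff)
    then show ?thesis by (simp add: map_concat o_def)
  qed
  let ?J = "\<lambda>i s. J (done @ concat (map Y [0..<i])) s \<and> map (snd s) [k..<?v] = pre"
  have "?J n (exec (For ?v ?c) s)"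
  proof (rule exec_For[where J = ?J and n = n])
    show "?v \<notin> mods ?c" "0 \<notin> mods ?c" "?v \<noteq> 0" using mods Suc.prems by auto
    show "snd s 0 = 0" by fact
    show "?J 0 (fst s, (snd s)(?v := 0))"
      using Suc.prems frame[of ?v "done" "fst s" "snd s" 0] by auto
    show "domain_word n (fst s)" if "?J i s" for i s using that shape by blast
    fix i s assume s: "?J i s" "i < n" "snd s ?v = i" "snd s 0 = 0"
    have split: "[0..<n] = [0..<i] @ i # [Suc i..<n]"
      using s(2) by (metis upt_conv_Cons upt_add_eq_append le_add_diff_inverse less_imp_le zero_le)
    have "J ((done @ concat (map Y [0..<i])) @ map ((@) (pre @ [i])) (product_lists (replicate r [0..<n])))
        (exec (loops (k + length (pre @ [i])) r c) s)"
    proof (rule Suc.IH)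
      show "all = (done @ concat (map Y [0..<i])) @ map ((@) (pre @ [i])) (product_lists (replicate r [0..<n])) @
          (concat (map Y [Suc i..<n]) @ rest)"
        using Suc.prems(1) unfolding X by (subst (asm) split) (simp add: Y_def)
      show "map (snd s) [k..<k + length (pre @ [i])] = pre @ [i]" using s by simp
    qed (use s Suc.prems in auto)
    then have "J (done @ concat (map Y [0..<Suc i])) (exec ?c s)" by (simp add: Y_def)
    moreover have "map (snd (exec ?c s)) [k..<?v] = map (snd s) [k..<?v]"
      using mods Suc.prems(2) s(4) by (intro map_cong refl exec_mods) auto
    ultimately show "?J (Suc i) (fst (exec ?c s), (snd (exec ?c s))(?v := Suc i))"
      using s frame[of ?v "done @ concat (map Y [0..<Suc i])" "fst (exec ?c s)" "snd (exec ?c s)" "Suc i"] Suc.prems(2)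
      by auto
  qed
  then show ?case unfolding X by simp
qed

text \<open>Pebble \<open>p\<close> walks through the table part of the tape while the nested loops enumerate the
  tuples in the order of \<open>encode\<close>, so that no address arithmetic is needed.\<close>

definition scan :: "'p list \<Rightarrow> ('p \<Rightarrow> nat) \<Rightarrow> nat \<Rightarrow> nat \<Rightarrow> ('p \<Rightarrow> cmd) \<Rightarrow> cmd" where
  "scan sig ar p k body = Seq (For p Skip) (Seq (Op (Inc p))
     (foldr (\<lambda>Q. Seq (loops k (ar Q) (Seq (body Q) (Op (Inc p))))) sig Skip))"

lemma mods_foldr: "mods (foldr (\<lambda>Q. Seq (f Q)) sig Skip) = (\<Union>Q\<in>set sig. mods (f Q))"
  by (induction sig) auto

lemma wf_foldr: "wf_cmd (foldr (\<lambda>Q. Seq (f Q)) sig Skip) \<longleftrightarrow> (\<forall>Q\<in>set sig. wf_cmd (f Q))"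
  by (induction sig) auto

lemma mods_scan: "mods (scan sig ar p k body) \<subseteq> insert p ({k..} \<union> (\<Union>Q\<in>set sig. mods (body Q)))"
  by (auto simp: scan_def mods_foldr)

lemma wf_scan:
  assumes "\<And>Q. Q \<in> set sig \<Longrightarrow> wf_cmd (body Q) \<and> mods (body Q) \<inter> {k..<k + ar Q} = {}" "p < k"
  shows "wf_cmd (scan sig ar p k body)"
proof -
  have "wf_cmd (loops k (ar Q) (Seq (body Q) (Op (Inc p))))" if "Q \<in> set sig" for Q
    using assms(1)[OF that] assms(2) by (intro wf_loops) auto
  then show ?thesis by (simp add: scan_def wf_foldr)
qed

lemma exec_scan:
  assumes body: "\<And>done Q ds rest s. entries sig ar n = done @ (Q, ds) # rest \<Longrightarrow> J done s \<Longrightarrow>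
      snd s 0 = 0 \<Longrightarrow> snd s p = n + 1 + length done \<Longrightarrow> map (snd s) [k..<k + ar Q] = ds \<Longrightarrow>
      J (done @ [(Q, ds)]) (exec (body Q) s)"
    and shape: "\<And>done s. J done s \<Longrightarrow> domain_word n (fst s)"
    and frame: "\<And>done w q v x. v = p \<or> k \<le> v \<Longrightarrow> J done (w, q) \<Longrightarrow> J done (w, q(v := x))"
    and mods: "\<And>Q. Q \<in> set sig \<Longrightarrow> mods (body Q) \<inter> ({0, p} \<union> {k..<k + ar Q}) = {}" "0 < p" "p < k"
    and s: "J [] s" "snd s 0 = 0"
  shows "J (entries sig ar n) (exec (scan sig ar p k body) s)"
proof -
  have upd: "J d s \<Longrightarrow> v = p \<or> k \<le> v \<Longrightarrow> J d (fst s, (snd s)(v := x))" for d s v x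
    using frame by (cases s) auto
  let ?K = "\<lambda>d s. J d s \<and> snd s p = n + 1 + length d \<and> snd s 0 = 0"
  define s' where "s' = act (Inc p) (exec (For p Skip) s)"
  \<comment> \<open>The empty loop carries \<open>p\<close> over the ones to the separator; the
    \<open>Inc\<close> after it reaches the first table cell.\<close>
  have "J [] (exec (For p Skip) s) \<and> snd (exec (For p Skip) s) p = n"
    by (rule exec_For[where J = "\<lambda>i s. J [] s \<and> snd s p = i" and n = n]) (use s mods(2) upd shape in auto)
  moreover have "snd (exec (For p Skip) s) 0 = 0" using s(2) mods(2) by (intro exec_zero) auto
  ultimately have s': "?K [] s'"
    using upd[of "[]" "exec (For p Skip) s" p] mods(2) by (cases "exec (For p Skip) s") (auto simp: s'_def)
  let ?sc = "\<lambda>sig. foldr (\<lambda>Q. Seq (loops k (ar Q) (Seq (body Q) (Op (Inc p))))) sig Skip"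
  have "?K d s \<Longrightarrow> entries sig ar n = d @ entries sig' ar n \<Longrightarrow> set sig' \<subseteq> set sig \<Longrightarrow>
      ?K (d @ entries sig' ar n) (exec (?sc sig') s)" for d s sig'
  proof (induction sig' arbitrary: d s)
    case Nil
    then show ?case by (simp add: entries_def)
  next
    case (Cons Q sig')
    let ?all = "product_lists (replicate (ar Q) [0..<n])"
    have ent: "entries (Q # sig') ar n = map (Pair Q) ?all @ entries sig' ar n" by (simp add: entries_def)
    have mQ: "mods (body Q) \<inter> ({0, p} \<union> {k..<k + ar Q}) = {}" using Cons.prems mods(1) by auto
    let ?c = "Seq (body Q) (Op (Inc p))"
    have "?K (d @ map (Pair Q) ([] @ map ((@) []) ?all)) (exec (loops (k + length ([] :: nat list)) (ar Q) ?c) s)"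
    proof (rule exec_loops[where J = "\<lambda>done. ?K (d @ map (Pair Q) done)"])
      fix "done" ds rest s
      assume a: "?all = done @ ds # rest" "?K (d @ map (Pair Q) done) s" "snd s 0 = 0"
        "map (snd s) [k..<k + ar Q] = ds"
      have "J ((d @ map (Pair Q) done) @ [(Q, ds)]) (exec (body Q) s)"
      proof (rule body)
        show "entries sig ar n = (d @ map (Pair Q) done) @ (Q, ds) # (map (Pair Q) rest @ entries sig' ar n)"
          using Cons.prems(2) unfolding ent a(1) by simp
      qed (use a in auto)
      moreover have "snd (exec (body Q) s) p = snd s p" "snd (exec (body Q) s) 0 = 0"
        using mQ a by (auto simp: exec_mods intro: exec_zero)
      ultimately show "?K (d @ map (Pair Q) (done @ [ds])) (exec ?c s)"
        using a(2) mods(2) upd[of "(d @ map (Pair Q) done) @ [(Q, ds)]" "exec (body Q) s" p "Suc (snd s p)"]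
        by (cases "exec (body Q) s") auto
    next
      show "?all = [] @ map ((@) []) ?all @ []" by (simp add: map_idI)
      show "mods ?c \<inter> {k..<k + ar Q} = {}" "0 \<notin> mods ?c" "0 < k" using mQ mods by auto
    qed (use Cons.prems shape frame mods in auto)
    then have "?K (d @ map (Pair Q) ?all) (exec (loops k (ar Q) ?c) s)" by (simp add: map_idI)
    from Cons.IH[OF this] show ?case using Cons.prems unfolding ent by simp
  qed
  from this[OF s', of sig] show ?thesis
    by (simp add: scan_def s'_def)
qed

text \<open>Pebbles also serve as Boolean registers: true means lying on the left end.\<close>

definition assign_flag :: "nat \<Rightarrow> bool \<Rightarrow> cmd" where
  "assign_flag k b = (if b then Op (Copy k 0) else Seq (Op (Copy k 0)) (Op (Inc k)))"

lemma exec_assign_flag: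
  "exec (assign_flag k b) (w, p) = (w, p(k := p 0 + (if b then 0 else 1)))"
  by (simp add: assign_flag_def)

lemma mods_assign_flag [simp]: "mods (assign_flag k b) = {k}"
  by (simp add: assign_flag_def)

lemma wf_assign_flag [simp]: "wf_cmd (assign_flag k b)"
  by (simp add: assign_flag_def)

section \<open>Evaluation of formulas, one bit at a time\<close>

fun match :: "(nat \<times> nat) list \<Rightarrow> cmd \<Rightarrow> cmd" where
  "match [] c = c"
| "match ((u, v) # uvs) c = Cond (Same u v) (match uvs c) Skip"

lemma zip_agree: "length us = length vs \<Longrightarrow> (\<forall>(u, v)\<in>set (zip us vs). f u = f v) \<longleftrightarrow> map f us = map f vs"
  by (induction us vs rule: list_induct2) auto

lemma mods_match [simp]: "mods (match uvs c) = mods c"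
  by (induction uvs c rule: match.induct) auto

lemma wf_match [simp]: "wf_cmd (match uvs c) = wf_cmd c"
  by (induction uvs c rule: match.induct) auto

lemma exec_match:
  assumes "\<And>u v. (u, v) \<in> set uvs \<Longrightarrow> snd s u < length (fst s)"
  shows "exec (match uvs c) s = (if \<forall>(u, v)\<in>set uvs. snd s u = snd s v then exec c s else s)"
  using assms
proof (induction uvs)
  case (Cons uv uvs)
  obtain u v where uv: "uv = (u, v)" by (cases uv)
  then have "holds (Same u v) s \<longleftrightarrow> snd s u = snd s v" using Cons.prems[of u v] by (cases s) auto
  moreover have "exec (match uvs c) s = (if \<forall>(u, v)\<in>set uvs. snd s u = snd s v then exec c s else s)"
    using Cons.prems by (intro Cons.IH) auto
  ultimately show ?case unfolding uv by auto
qed simp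

text \<open>Register \<open>k\<close> takes the answer, \<open>k + 1\<close> walks the table, and
  the pebbles from \<open>k + 2\<close> enumerate tuples; the wanted one is recognised by comparing
  pebbles.\<close>

definition lookup :: "'p list \<Rightarrow> ('p \<Rightarrow> nat) \<Rightarrow> bool \<Rightarrow> nat \<Rightarrow> 'p \<Rightarrow> nat list \<Rightarrow> cmd" where
  "lookup sig ar b k P vs = Seq (assign_flag k False) (scan sig ar (k + 1) (k + 2) (\<lambda>Q.
     if Q = P \<and> length vs = ar P
     then match (zip [k + 2..<k + 2 + ar P] vs)
       (Cond (Base (k + 1) {if b then 3 else 4, 6}) (assign_flag k True) Skip)
     else Skip))"

text \<open>Both operands answer in register \<open>k\<close>: the second runs only if the first
  leaves the result open, and then overwrites it.\<close>

definition junction :: "bool \<Rightarrow> nat \<Rightarrow> cmd \<Rightarrow> cmd \<Rightarrow> cmd" where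
  "junction b k c d = Seq c (if b then Cond (Same 0 k) d Skip else Cond (Same 0 k) Skip d)"

definition quantifier :: "bool \<Rightarrow> nat \<Rightarrow> cmd \<Rightarrow> cmd" where
  "quantifier b k c = Seq (assign_flag k b) (For (k + 1) (Seq c
     (if b then Cond (Same 0 (k + 2)) Skip (assign_flag k False)
      else Cond (Same 0 (k + 2)) (assign_flag k True) Skip)))"

text \<open>Only bit \<open>b\<close> is decided: negation asks for the other bit instead, and
  \<open>Conj\<close> or \<open>All\<close> become a disjunctive search when the bit is
  \<open>False\<close>. \<open>\<rho>\<close> sends variables to pebbles.\<close>

fun evaluate :: "'p list \<Rightarrow> ('p \<Rightarrow> nat) \<Rightarrow> bool \<Rightarrow> (nat \<Rightarrow> nat) \<Rightarrow> nat \<Rightarrow> 'p fm \<Rightarrow> cmd" where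
  "evaluate sig ar b \<rho> k (Atom P xs) = lookup sig ar b k P (map \<rho> xs)"
| "evaluate sig ar b \<rho> k (Eq x y) = Cond (Same (\<rho> x) (\<rho> y)) (assign_flag k b) (assign_flag k (\<not> b))"
| "evaluate sig ar b \<rho> k (Neg f) = evaluate sig ar (\<not> b) \<rho> k f"
| "evaluate sig ar b \<rho> k (Conj f g) = junction b k (evaluate sig ar b \<rho> k f) (evaluate sig ar b \<rho> k g)"
| "evaluate sig ar b \<rho> k (Disj f g) = junction (\<not> b) k (evaluate sig ar b \<rho> k f) (evaluate sig ar b \<rho> k g)"
| "evaluate sig ar b \<rho> k (All x f) = quantifier b k (evaluate sig ar b (\<rho>(x := k + 1)) (k + 2) f)"
| "evaluate sig ar b \<rho> k (Ex x f) = quantifier (\<not> b) k (evaluate sig ar b (\<rho>(x := k + 1)) (k + 2) f)"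

lemma mods_lookup: "mods (lookup sig ar b k P vs) \<subseteq> {k..}"
  using mods_scan[of sig ar "k + 1" "k + 2"] by (fastforce simp: lookup_def split: if_splits)

lemma wf_lookup: "wf_cmd (lookup sig ar b k P vs)"
  unfolding lookup_def wf_cmd.simps by (intro conjI wf_scan) (auto split: if_splits)

lemma mods_evaluate: "mods (evaluate sig ar b \<rho> k f) \<subseteq> {k..}"
proof (induction f arbitrary: b \<rho> k)
  case (Atom P xs)
  then show ?case using mods_lookup by simp
next
  case (All x f)
  have "mods (evaluate sig ar b (\<rho>(x := k + 1)) (k + 2) f) \<subseteq> {k..}"
    by (rule order_trans[OF All]) simp
  then show ?case by (simp add: quantifier_def)
next
  case (Ex x f)
  have "mods (evaluate sig ar b (\<rho>(x := k + 1)) (k + 2) f) \<subseteq> {k..}"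
    by (rule order_trans[OF Ex]) simp
  then show ?case by (simp add: quantifier_def)
qed (simp_all add: junction_def)

lemma wf_evaluate: "wf_cmd (evaluate sig ar b \<rho> k f)"
proof (induction f arbitrary: b \<rho> k)
  case (Atom P xs)
  then show ?case using wf_lookup by simp
next
  case (All x f)
  then show ?case using mods_evaluate[of sig ar b "\<rho>(x := k + 1)" "k + 2" f] by (auto simp: quantifier_def)
next
  case (Ex x f)
  then show ?case using mods_evaluate[of sig ar b "\<rho>(x := k + 1)" "k + 2" f] by (auto simp: quantifier_def)
qed (simp_all add: junction_def)

lemma supports_glb_image: "supports b (glb_t (g ` {..<n})) \<longleftrightarrow>
    (if b then \<forall>i<n. supports b (g i) else \<exists>i<n. supports b (g i))"
  by (auto simp: supports_glb simp del: supports_simps)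

lemma supports_lub_image: "supports b (lub_t (g ` {..<n})) \<longleftrightarrow>
    (if b then \<exists>i<n. supports b (g i) else \<forall>i<n. supports b (g i))"
  by (auto simp: supports_lub simp del: supports_simps)

definition decides :: "cmd \<Rightarrow> nat \<Rightarrow> store \<Rightarrow> bool \<Rightarrow> bool" where
  "decides c k s b \<longleftrightarrow> fst (exec c s) = fst s \<and> (snd (exec c s) k = 0 \<longleftrightarrow> b)"

lemma decides_junction:
  assumes "decides c k s P" "decides d k (exec c s) Q" "snd (exec c s) 0 = 0" "fst s \<noteq> []"
  shows "decides (junction b k c d) k s (if b then P \<and> Q else P \<or> Q)"
proof -
  obtain w p where e: "exec c s = (w, p)" by (cases "exec c s")
  have "holds (Same 0 k) (exec c s) \<longleftrightarrow> P"
    using assms unfolding e by (auto simp: decides_def e)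
  then show ?thesis using assms by (auto simp: decides_def junction_def)
qed

lemma decides_quantifier:
  assumes c: "\<And>i s'. i < n \<Longrightarrow> fst s' = fst s \<Longrightarrow> snd s' (k + 1) = i \<Longrightarrow> (\<forall>v<k. snd s' v = snd s v) \<Longrightarrow>
      decides c (k + 2) s' (P i)"
    and mods: "mods c \<subseteq> {k + 2..}" "0 < k" and s: "snd s 0 = 0" "domain_word n (fst s)"
  shows "decides (quantifier b k c) k s (if b then \<forall>i<n. P i else \<exists>i<n. P i)"
proof -
  let ?d = "if b then Cond (Same 0 (k + 2)) Skip (assign_flag k False)
      else Cond (Same 0 (k + 2)) (assign_flag k True) Skip"
  let ?s = "exec (assign_flag k b) s"
  let ?J = "\<lambda>i s'. fst s' = fst s \<and> (\<forall>v<k. snd s' v = snd s v) \<and>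
     (snd s' k = 0 \<longleftrightarrow> (if b then \<forall>j<i. P j else \<exists>j<i. P j))"
  have "?J n (exec (For (k + 1) (Seq c ?d)) ?s)"
  proof (rule exec_For[where J = ?J and n = n])
    show "k + 1 \<notin> mods (Seq c ?d)" "0 \<notin> mods (Seq c ?d)" using mods by auto
    show "k + 1 \<noteq> 0" by simp
    show "snd ?s 0 = 0" using s mods by (cases s) (simp add: exec_assign_flag)
    show "?J 0 (fst ?s, (snd ?s)(k + 1 := 0))" using s mods by (cases s) (auto simp: exec_assign_flag)
    show "domain_word n (fst s')" if "?J i s'" for i s' using that s by simp
    fix i s' assume a: "?J i s'" "i < n" "snd s' (k + 1) = i" "snd s' 0 = 0"
    obtain w p where e: "exec c s' = (w, p)" by (cases "exec c s'")
    have "decides c (k + 2) s' (P i)" using a by (intro c) auto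
    then have w: "w = fst s" "p (k + 2) = 0 \<longleftrightarrow> P i" using a by (auto simp: decides_def e)
    have p: "p v = snd s' v" if "v \<le> k" for v
    proof -
      have "v \<notin> mods c" "0 \<notin> mods c" using mods that by fastforce+
      then show ?thesis using exec_mods[of v c s'] a by (simp add: e)
    qed
    have "holds (Same 0 (k + 2)) (w, p) \<longleftrightarrow> P i"
      using w p[of 0] a domain_word_length[OF s(2)] by auto
    moreover have "p k = snd s' k" "\<forall>v<k. p v = snd s v" "p 0 = 0" using p a by auto
    ultimately show "?J (Suc i) (fst (exec (Seq c ?d) s'), (snd (exec (Seq c ?d) s'))(k + 1 := Suc i))"
      using a w mods by (auto simp: e exec_assign_flag less_Suc_eq simp del: holds.simps)
  qed
  then show ?thesis by (auto simp: decides_def quantifier_def)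
qed

lemma nth_encode:
  assumes "entries sig ar n = done @ (P, ds) # rest"
  shows "encode sig ar n J ! (n + 1 + length done) = code_tv (J P ds)"
  by (simp add: encode_entries assms nth_append)

lemma decides_lookup:
  assumes J: "wf_struct sig ar n J" and s: "fst s = encode sig ar n J" "snd s 0 = 0" "0 < k"
    and vs: "\<forall>v\<in>set vs. v < k"
  shows "decides (lookup sig ar b k P vs) k s (supports b (J P (map (snd s) vs)))"
proof -
  define c where "c Q = (if Q = P \<and> length vs = ar P
     then match (zip [k + 2..<k + 2 + ar P] vs)
       (Cond (Base (k + 1) {if b then 3 else 4, 6}) (assign_flag k True) Skip)
     else Skip)" for Q
  let ?ds = "map (snd s) vs"
  let ?s = "exec (assign_flag k False) s"
  let ?J = "\<lambda>done s'. fst s' = fst s \<and> (\<forall>v<k. snd s' v = snd s v) \<and>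
     (snd s' k = 0 \<longleftrightarrow> (P, ?ds) \<in> set done \<and> supports b (J P ?ds))"
  have "?J (entries sig ar n) (exec (scan sig ar (k + 1) (k + 2) c) ?s)"
  proof (rule exec_scan[where J = ?J and n = n])
    show "?J [] ?s" "snd ?s 0 = 0" using s by (cases s; auto simp: exec_assign_flag)+
    show "domain_word n (fst s')" if "?J done s'" for "done" s'
      using that s domain_word_encode by metis
    show "?J done (w, q(v := x))" if "v = k + 1 \<or> k + 2 \<le> v" "?J done (w, q)" for "done" w q v x
      using that by auto
    show "mods (c Q) \<inter> ({0, k + 1} \<union> {k + 2..<k + 2 + ar Q}) = {}" for Q
      using s by (auto simp: c_def)
    show "0 < k + 1" "k + 1 < k + 2" by auto
    fix "done" Q ds rest s'
    assume ent: "entries sig ar n = done @ (Q, ds) # rest" and K: "?J done s'"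
      and a: "snd s' 0 = 0" "snd s' (k + 1) = n + 1 + length done"
        "map (snd s') [k + 2..<k + 2 + ar Q] = ds"
    have "(Q, ds) \<in> set (entries sig ar n)" unfolding ent by simp
    then have ds: "length ds = ar Q" "set ds \<subseteq> {..<n}" by (auto simp: set_entries)
    have len: "n + 1 + length done < length (fst s')"
      using K s ent by (simp add: length_encode)
    show "?J (done @ [(Q, ds)]) (exec (c Q) s')"
    proof (cases "Q = P \<and> length vs = ar P")
      case True
      let ?uvs = "zip [k + 2..<k + 2 + ar P] vs"
      have "snd s' u < length (fst s')" if "(u, v) \<in> set ?uvs" for u v
      proof -
        have "u \<in> set [k + 2..<k + 2 + ar P]" using that by (rule set_zip_leftD)
        then have "snd s' u \<in> set ds" using a(3) True by (metis image_eqI list.set_map)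
        then show ?thesis using ds len by auto
      qed
      moreover have "map (snd s') vs = ?ds" using vs K by simp
      moreover have "(\<forall>(u, v)\<in>set ?uvs. snd s' u = snd s' v) \<longleftrightarrow>
          map (snd s') [k + 2..<k + 2 + ar P] = map (snd s') vs"
        using True by (intro zip_agree) auto
      ultimately have ex: "exec (c Q) s' = (if ds = ?ds
          then exec (Cond (Base (k + 1) {if b then 3 else 4, 6}) (assign_flag k True) Skip) s' else s')"
        using True a(3) unfolding c_def by (subst if_P, simp, subst exec_match) auto
      have "holds (Base (k + 1) {if b then 3 else 4, 6}) s' \<longleftrightarrow> supports b (J Q ds)"
        using len K s(1) a(2) nth_encode[OF ent, of J] unfolding supports_code by (cases s') auto
      then show ?thesis
        using K True a(1) s(3) unfolding ex by (cases s') (auto simp: exec_assign_flag simp del: holds.simps)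
    next
      case False
      then have "(Q, ds) \<noteq> (P, ?ds)" using ds by auto
      then show ?thesis using K False by (auto simp: c_def)
    qed
  qed
  \<comment> \<open>Tuples that the scan never meets have value \<open>Uu\<close> by normalisation,
    so the initial flag \<open>False\<close> is right for them.\<close>
  moreover have "supports b (J P ?ds) \<Longrightarrow> (P, ?ds) \<in> set (entries sig ar n)"
    by (rule ccontr) (use wf_struct_entries[OF J, of P ?ds] in \<open>cases b; auto\<close>)
  moreover have "lookup sig ar b k P vs = Seq (assign_flag k False) (scan sig ar (k + 1) (k + 2) c)"
    unfolding lookup_def c_def ..
  ultimately show ?thesis by (auto simp: decides_def)
qed

text \<open>Positions need only be at most \<open>n\<close>: the default pebble 0 lies on cell 0,
  which is no element of an empty domain, and comparisons merely require cells of the tape.\<close>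

lemma decides_evaluate:
  assumes J: "wf_struct sig ar n J"
  shows "fst s = encode sig ar n J \<Longrightarrow> snd s 0 = 0 \<Longrightarrow> 0 < k \<Longrightarrow> \<forall>y. \<rho> y < k \<and> snd s (\<rho> y) \<le> n \<Longrightarrow>
    decides (evaluate sig ar b \<rho> k f) k s (supports b (eval n J (\<lambda>y. snd s (\<rho> y)) f))"
proof (induction f arbitrary: b \<rho> k s)
  case (Atom P xs)
  then show ?case using decides_lookup[OF J, of s k "map \<rho> xs" b P] by (simp add: o_def)
next
  case (Eq x y)
  have "n < length (fst s)" using Eq(1) by (simp add: length_encode)
  then have "holds (Same (\<rho> x) (\<rho> y)) s \<longleftrightarrow> snd s (\<rho> x) = snd s (\<rho> y)"
    using Eq.prems(4) by (cases s) (auto intro: le_less_trans)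
  then show ?case using Eq.prems
    by (cases s; cases b) (auto simp: decides_def exec_assign_flag simp del: holds.simps)
next
  case (Neg f)
  then show ?case using Neg.IH[of s k \<rho> "\<not> b"] by (simp add: supports_inv del: supports_simps)
next
  case (Conj f g)
  let ?s = "exec (evaluate sig ar b \<rho> k f) s"
  have f: "decides (evaluate sig ar b \<rho> k f) k s (supports b (eval n J (\<lambda>y. snd s (\<rho> y)) f))"
    using Conj by blast
  have v: "snd ?s v = snd s v" if "v < k" for v
    using that mods_evaluate[of sig ar b \<rho> k f] Conj.prems by (intro exec_mods) auto
  have "decides (evaluate sig ar b \<rho> k g) k ?s (supports b (eval n J (\<lambda>y. snd ?s (\<rho> y)) g))"
    using Conj.prems v f by (intro Conj.IH) (auto simp: decides_def)
  then have "decides (evaluate sig ar b \<rho> k g) k ?s (supports b (eval n J (\<lambda>y. snd s (\<rho> y)) g))"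
    using v Conj.prems by simp
  from decides_junction[OF f this, of b] show ?case
    using v[of 0] Conj.prems by (cases b) (simp_all add: supports_glb encode_entries del: supports_simps)
next
  case (Disj f g)
  let ?s = "exec (evaluate sig ar b \<rho> k f) s"
  have f: "decides (evaluate sig ar b \<rho> k f) k s (supports b (eval n J (\<lambda>y. snd s (\<rho> y)) f))"
    using Disj by blast
  have v: "snd ?s v = snd s v" if "v < k" for v
    using that mods_evaluate[of sig ar b \<rho> k f] Disj.prems by (intro exec_mods) auto
  have "decides (evaluate sig ar b \<rho> k g) k ?s (supports b (eval n J (\<lambda>y. snd ?s (\<rho> y)) g))"
    using Disj.prems v f by (intro Disj.IH) (auto simp: decides_def)
  then have "decides (evaluate sig ar b \<rho> k g) k ?s (supports b (eval n J (\<lambda>y. snd s (\<rho> y)) g))"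
    using v Disj.prems by simp
  from decides_junction[OF f this, of "\<not> b"] show ?case
    using v[of 0] Disj.prems by (cases b) (simp_all add: supports_lub encode_entries del: supports_simps)
next
  case (All x f)
  let ?\<theta> = "\<lambda>y. snd s (\<rho> y)"
  have "decides (quantifier b k (evaluate sig ar b (\<rho>(x := k + 1)) (k + 2) f)) k s
    (if b then \<forall>i<n. supports b (eval n J (?\<theta>(x := i)) f) else \<exists>i<n. supports b (eval n J (?\<theta>(x := i)) f))"
  proof (rule decides_quantifier)
    fix i s' assume a: "i < n" "fst s' = fst s" "snd s' (k + 1) = i" "\<forall>v<k. snd s' v = snd s v"
    have "(\<lambda>y. snd s' ((\<rho>(x := k + 1)) y)) = ?\<theta>(x := i)" using a All.prems by auto
    moreover have "decides (evaluate sig ar b (\<rho>(x := k + 1)) (k + 2) f) (k + 2) s'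
       (supports b (eval n J (\<lambda>y. snd s' ((\<rho>(x := k + 1)) y)) f))"
      using a All.prems by (intro All.IH) (auto simp: less_Suc_eq)
    ultimately show "decides (evaluate sig ar b (\<rho>(x := k + 1)) (k + 2) f) (k + 2) s'
       (supports b (eval n J (?\<theta>(x := i)) f))" by simp
  qed (use All.prems domain_word_encode[of n sig ar J] mods_evaluate[of sig ar b "\<rho>(x := k + 1)" "k + 2" f] in auto)
  then show ?case by (cases b) (simp_all add: supports_glb_image del: supports_simps)
next
  case (Ex x f)
  let ?\<theta> = "\<lambda>y. snd s (\<rho> y)"
  have "decides (quantifier (\<not> b) k (evaluate sig ar b (\<rho>(x := k + 1)) (k + 2) f)) k s
    (if \<not> b then \<forall>i<n. supports b (eval n J (?\<theta>(x := i)) f) else \<exists>i<n. supports b (eval n J (?\<theta>(x := i)) f))"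
  proof (rule decides_quantifier)
    fix i s' assume a: "i < n" "fst s' = fst s" "snd s' (k + 1) = i" "\<forall>v<k. snd s' v = snd s v"
    have "(\<lambda>y. snd s' ((\<rho>(x := k + 1)) y)) = ?\<theta>(x := i)" using a Ex.prems by auto
    moreover have "decides (evaluate sig ar b (\<rho>(x := k + 1)) (k + 2) f) (k + 2) s'
       (supports b (eval n J (\<lambda>y. snd s' ((\<rho>(x := k + 1)) y)) f))"
      using a Ex.prems by (intro Ex.IH) (auto simp: less_Suc_eq)
    ultimately show "decides (evaluate sig ar b (\<rho>(x := k + 1)) (k + 2) f) (k + 2) s'
       (supports b (eval n J (?\<theta>(x := i)) f))" by simp
  qed (use Ex.prems domain_word_encode[of n sig ar J] mods_evaluate[of sig ar b "\<rho>(x := k + 1)" "k + 2" f] in auto)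
  then show ?case by (cases b) (simp_all add: supports_lub_image del: supports_simps)
qed

text \<open>Pebble 0 marks the left end, 1 counts rounds, 2 walks the table, those from 3 hold the
  current tuple, and those from \<open>3 + ar Q\<close> serve the evaluation. Bit
  \<open>True\<close> suffices, since a propagator fires on \<open>leq_p Tt\<close>.\<close>

definition update_cmd :: "'p list \<Rightarrow> ('p \<Rightarrow> nat) \<Rightarrow> 'p inf_sentence \<Rightarrow> 'p \<Rightarrow> cmd" where
  "update_cmd sig ar \<phi> Q = (if Q = inf_pred \<phi> then
     Seq (evaluate sig ar True (assign (inf_vars \<phi>) [3..<3 + ar Q]) (3 + ar Q) (inf_body \<phi>))
         (Cond (Same 0 (3 + ar Q)) (Op (Join 2 (inf_pos \<phi>))) Skip)
     else Skip)"

definition pass_cmd :: "'p list \<Rightarrow> ('p \<Rightarrow> nat) \<Rightarrow> 'p inf_sentence list \<Rightarrow> cmd" where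
  "pass_cmd sig ar \<phi>s = foldr (\<lambda>\<phi>. Seq (scan sig ar 2 3 (update_cmd sig ar \<phi>))) \<phi>s Skip"

text \<open>Two passes per tape cell suffice, since every entry can gain precision at most twice.\<close>

definition main_cmd :: "'p list \<Rightarrow> ('p \<Rightarrow> nat) \<Rightarrow> 'p inf_sentence list \<Rightarrow> cmd" where
  "main_cmd sig ar \<phi>s = Seq (Op (Copy 1 0))
     (While 1 {1..6} (Seq (pass_cmd sig ar \<phi>s) (pass_cmd sig ar \<phi>s)))"

lemma mods_update_cmd: "mods (update_cmd sig ar \<phi> Q) \<subseteq> {3 + ar Q..}"
  by (simp add: update_cmd_def mods_evaluate)

lemma mods_pass_cmd: "mods (pass_cmd sig ar \<phi>s) \<subseteq> {2..}"
proof -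
  have "mods (update_cmd sig ar \<phi> Q) \<subseteq> {2..}" for \<phi> Q
    by (rule order_trans[OF mods_update_cmd]) simp
  then have "mods (scan sig ar 2 3 (update_cmd sig ar \<phi>)) \<subseteq> {2..}" for \<phi>
    by (intro order_trans[OF mods_scan]) auto
  then show ?thesis unfolding pass_cmd_def mods_foldr by blast
qed

lemma wf_pass_cmd: "wf_cmd (pass_cmd sig ar \<phi>s)"
proof -
  have "wf_cmd (scan sig ar 2 3 (update_cmd sig ar \<phi>))" for \<phi>
  proof (rule wf_scan)
    fix Q
    have "mods (update_cmd sig ar \<phi> Q) \<inter> {3..<3 + ar Q} = {}"
      using mods_update_cmd[of sig ar \<phi> Q] by fastforce
    then show "wf_cmd (update_cmd sig ar \<phi> Q) \<and> mods (update_cmd sig ar \<phi> Q) \<inter> {3..<3 + ar Q} = {}"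
      by (simp add: update_cmd_def wf_evaluate)
  qed simp
  then show ?thesis unfolding pass_cmd_def wf_foldr by blast
qed

lemma wf_main_cmd: "wf_cmd (main_cmd sig ar \<phi>s)" "0 \<notin> mods (main_cmd sig ar \<phi>s)"
proof -
  have "0 \<notin> mods (pass_cmd sig ar \<phi>s)" "1 \<notin> mods (pass_cmd sig ar \<phi>s)"
    using mods_pass_cmd[of sig ar \<phi>s] by force+
  then show "wf_cmd (main_cmd sig ar \<phi>s)" "0 \<notin> mods (main_cmd sig ar \<phi>s)"
    by (simp_all add: main_cmd_def wf_pass_cmd)
qed

text \<open>Passes from pebbles to their positions. \<open>f 0 = 0\<close> makes the defaults agree:
  pebble 0 lies on cell 0.\<close>

lemma assign_map: "f 0 = 0 \<Longrightarrow> assign xs (map f us) y = f (assign xs us y)"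
proof (induction xs arbitrary: us)
  case (Cons x xs)
  then show ?case by (cases us) (auto simp: assign_def)
qed (simp add: assign_def)

lemma assign_in: "assign xs us y \<in> insert 0 (set us)"
  by (auto simp: assign_def split: option.splits dest!: map_of_SomeD set_zip_rightD)

text \<open>Distinct entries give the changed value exactly one cell.\<close>

lemma encode_update:
  assumes "distinct sig" "entries sig ar n = done @ (P, ds) # rest"
  shows "encode sig ar n (J(P := (J P)(ds := v))) = (encode sig ar n J)[n + 1 + length done := code_tv v]"
proof -
  have "distinct (done @ (P, ds) # rest)" using distinct_entries[OF assms(1), of ar n] assms(2) by simp
  then have "map (\<lambda>(Q, es). code_tv ((J(P := (J P)(ds := v))) Q es)) done = map (\<lambda>(Q, es). code_tv (J Q es)) done"
    "map (\<lambda>(Q, es). code_tv ((J(P := (J P)(ds := v))) Q es)) rest = map (\<lambda>(Q, es). code_tv (J Q es)) rest"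
    by (auto intro!: map_cong)
  then show ?thesis unfolding encode_entries assms(2)
    by (simp add: list_update_append)
qed

lemma exec_update_cmd:
  assumes sig: "distinct sig" and ent: "entries sig ar n = done @ (Q, ds) # rest"
    and J: "wf_struct sig ar n J" "fst s = encode sig ar n J" "snd s 0 = 0"
    and p: "snd s 2 = n + 1 + length done" "map (snd s) [3..<3 + ar Q] = ds"
  shows "fst (exec (update_cmd sig ar \<phi> Q) s) = encode sig ar n (update n \<phi> (Q, ds) J)"
proof (cases "Q = inf_pred \<phi>")
  case True
  let ?k = "3 + ar Q"
  let ?\<rho> = "assign (inf_vars \<phi>) [3..<?k]"
  let ?c = "evaluate sig ar True ?\<rho> ?k (inf_body \<phi>)"
  obtain w q where e: "exec ?c s = (w, q)" by (cases "exec ?c s")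
  have mods: "mods ?c \<subseteq> {?k..}" by (rule mods_evaluate)
  then have m: "0 \<notin> mods ?c" "2 \<notin> mods ?c" by fastforce+
  then have q: "q 0 = 0" "q 2 = n + 1 + length done"
    using exec_mods[of 0 ?c s] exec_mods[of 2 ?c s] J p by (simp_all add: e)
  have "(Q, ds) \<in> set (entries sig ar n)" unfolding ent by simp
  then have ds: "set ds \<subseteq> {..<n}" by (auto simp: set_entries)
  have a: "snd s (?\<rho> y) = assign (inf_vars \<phi>) ds y" for y
    using assign_map[of "snd s"] J(3) p(2) by metis
  have "?\<rho> y < ?k \<and> snd s (?\<rho> y) \<le> n" for y
    using assign_in[of "inf_vars \<phi>" "[3..<?k]" y] assign_in[of "inf_vars \<phi>" ds y] ds unfolding a by auto
  then have "decides ?c ?k s (supports True (eval n J (\<lambda>y. snd s (?\<rho> y)) (inf_body \<phi>)))"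
    using J by (intro decides_evaluate) auto
  then have d: "w = encode sig ar n J"
    "q ?k = 0 \<longleftrightarrow> supports True (eval n J (assign (inf_vars \<phi>) ds) (inf_body \<phi>))"
    by (simp_all add: decides_def e J a)
  have "holds (Same 0 ?k) (w, q) \<longleftrightarrow> supports True (eval n J (assign (inf_vars \<phi>) ds) (inf_body \<phi>))"
    using q d(2) unfolding d(1) by (auto simp: length_encode simp del: supports_simps)
  moreover have "exec (update_cmd sig ar \<phi> Q) s = exec (Cond (Same 0 ?k) (Op (Join 2 (inf_pos \<phi>))) Skip) (exec ?c s)"
    using True by (simp add: update_cmd_def)
  ultimately have "fst (exec (update_cmd sig ar \<phi> Q) s) =
      (if supports True (eval n J (assign (inf_vars \<phi>) ds) (inf_body \<phi>))
       then w[q 2 := join_code (inf_pos \<phi>) (w ! q 2)] else w)"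
    unfolding e by (simp del: holds.simps supports_simps)
  moreover have "update n \<phi> (Q, ds) J =
      (if supports True (eval n J (assign (inf_vars \<phi>) ds) (inf_body \<phi>))
       then J(Q := (J Q)(ds := lub_p {if inf_pos \<phi> then Tt else Ff, J Q ds})) else J)"
    using True by (simp add: update_def del: supports_simps)
  ultimately show ?thesis
    unfolding d(1) q(2) nth_encode[OF ent]
    by (cases "supports True (eval n J (assign (inf_vars \<phi>) ds) (inf_body \<phi>))")
      (simp_all only: if_True if_False encode_update[OF sig ent] code_lub_p)
next
  case False
  then show ?thesis by (simp add: update_cmd_def update_def J)
qed

lemma exec_pass_cmd:
  assumes sig: "distinct sig"
  shows "wf_struct sig ar n J \<Longrightarrow> fst s = encode sig ar n J \<Longrightarrow> snd s 0 = 0 \<Longrightarrow>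
    fst (exec (pass_cmd sig ar \<phi>s) s) = encode sig ar n (pass sig ar n \<phi>s J)"
proof (induction \<phi>s arbitrary: J s)
  case Nil
  then show ?case by (simp add: pass_cmd_def pass_def)
next
  case (Cons \<phi> \<phi>s)
  let ?c = "scan sig ar 2 3 (update_cmd sig ar \<phi>)"
  let ?F = "\<lambda>es. fold (update n \<phi>) es J"
  \<comment> \<open>Later bodies read cells already altered; the fold over the visited entries
    describes this intermediate table.\<close>
  let ?J = "\<lambda>done s. fst s = encode sig ar n (?F done)"
  have wf: "set es \<subseteq> set (entries sig ar n) \<Longrightarrow> wf_struct sig ar n (fold (update n \<phi>) es J)" for es
    using Cons.prems(1) by (induction es rule: rev_induct) (auto intro: update_wf)
  have "?J (entries sig ar n) (exec ?c s)"
  proof (rule exec_scan[where J = ?J and n = n])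
    fix "done" Q ds rest s
    assume ent: "entries sig ar n = done @ (Q, ds) # rest" and a: "?J done s" "snd s 0 = 0"
      "snd s 2 = n + 1 + length done" "map (snd s) [3..<3 + ar Q] = ds"
    have "wf_struct sig ar n (?F done)" by (rule wf) (auto simp: ent)
    from exec_update_cmd[OF sig ent this a] show "?J (done @ [(Q, ds)]) (exec (update_cmd sig ar \<phi> Q) s)" by simp
  next
    fix Q
    show "mods (update_cmd sig ar \<phi> Q) \<inter> ({0, 2} \<union> {3..<3 + ar Q}) = {}"
      using mods_update_cmd[of sig ar \<phi> Q] by fastforce
  qed (use Cons.prems domain_word_encode in auto)
  moreover have "snd (exec ?c s) 0 = 0"
  proof (rule exec_zero)
    show "0 \<notin> mods ?c" using mods_pass_cmd[of sig ar "[\<phi>]"] by (fastforce simp: pass_cmd_def)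
  qed (use Cons in auto)
  ultimately have "fst (exec (pass_cmd sig ar \<phi>s) (exec ?c s)) = encode sig ar n (pass sig ar n \<phi>s (?F (entries sig ar n)))"
    by (intro Cons.IH wf) auto
  then show ?case by (simp add: pass_cmd_def pass_def)
qed

lemma encode_alphabet: "set (encode sig ar n J) \<subseteq> {1..6}"
  by (auto simp: encode_entries code_tv_def split: tv.splits)

lemma exec_main_cmd:
  assumes sig: "distinct sig" and V: "\<forall>\<phi>\<in>set \<phi>s. is_INF sig ar \<phi>"
    and J: "wf_struct sig ar n J" "fst s = encode sig ar n J" "snd s 0 = 0"
  shows "fst (exec (main_cmd sig ar \<phi>s) s) = encode sig ar n (lim ((\<lambda>\<phi>. INF_prop n \<phi>) ` set \<phi>s) J)"
proof -
  let ?P = "pass_cmd sig ar \<phi>s"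
  let ?F = "\<lambda>i. (pass sig ar n \<phi>s ^^ (2 * i)) J"
  let ?N = "length (fst s)"
  let ?s = "act (Copy 1 0) s"
  have wf: "wf_struct sig ar n ((pass sig ar n \<phi>s ^^ i) J)" for i
    by (induction i) (auto simp: J pass_wf)
  have mods: "0 \<notin> mods ?P" "1 \<notin> mods ?P" using mods_pass_cmd[of sig ar \<phi>s] by force+
  let ?J = "\<lambda>i s. fst s = encode sig ar n (?F i) \<and> snd s 1 = i \<and> snd s 0 = 0"
  have N: "length (encode sig ar n K) = ?N" for K by (simp add: J length_encode)
  have "?J ?N (exec (While 1 {1..6} (Seq ?P ?P)) ?s)"
  proof (rule exec_While[where J = ?J and m = ?N])
    show "?J 0 ?s" using J by (cases s) auto
    show "holds (Base 1 {1..6}) s' \<longleftrightarrow> i < ?N" if "?J i s'" "i \<le> ?N" for i s'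
    proof -
      have "i < ?N \<Longrightarrow> encode sig ar n (?F i) ! i \<in> {1..6}"
        using N[of "?F i"] encode_alphabet[of sig ar n "?F i"] by (metis nth_mem subsetD)
      then show ?thesis using that N[of "?F i"] by (cases s') auto
    qed
    show "?J (Suc i) (act (Inc 1) (exec (Seq ?P ?P) s'))" if "?J i s'" for i s'
    proof -
      have "fst (exec ?P s') = encode sig ar n ((pass sig ar n \<phi>s ^^ (Suc (2 * i))) J)"
        using exec_pass_cmd[OF sig wf, of s' "2 * i" \<phi>s] that by simp
      then have "fst (exec ?P (exec ?P s')) = encode sig ar n (?F (Suc i))"
        using exec_pass_cmd[OF sig wf, of "exec ?P s'" "Suc (2 * i)" \<phi>s] exec_zero[OF mods(1), of s'] that by simp
      then show ?thesis
        using that mods by (cases "exec ?P (exec ?P s')") (auto simp: exec_mods dest!: arg_cong[of _ _ snd])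
    qed
  qed (use J in \<open>cases s; simp\<close>)
  then have "fst (exec (main_cmd sig ar \<phi>s) s) = encode sig ar n (?F ?N)"
    by (simp add: main_cmd_def)
  \<comment> \<open>The tape has \<open>n + 1\<close> more cells than there are entries, which makes
    the inequality strict.\<close>
  moreover have "2 * length (entries sig ar n) < 2 * ?N" using J by (simp add: length_encode)
  ultimately show ?thesis using iterated_pass_lim[OF V J(1)] by simp
qed

section \<open>Polynomial bounds\<close>

definition poly_bounded :: "(nat \<Rightarrow> nat) \<Rightarrow> bool" where
  "poly_bounded f \<longleftrightarrow> (\<exists>c k. \<forall>n. f n \<le> c * (n + 1) ^ k)"

lemma poly_bounded_const: "poly_bounded (\<lambda>n. a)"
  unfolding poly_bounded_def by (rule exI[of _ a], rule exI[of _ 0]) simp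

lemma poly_bounded_power: "poly_bounded (\<lambda>n. n ^ r)"
  unfolding poly_bounded_def by (rule exI[of _ 1], rule exI[of _ r]) (simp add: power_mono)

lemma poly_bounded_id: "poly_bounded (\<lambda>n. n)"
  using poly_bounded_power[of 1] by simp

lemma poly_bounded_add: "poly_bounded f \<Longrightarrow> poly_bounded g \<Longrightarrow> poly_bounded (\<lambda>n. f n + g n)"
  unfolding poly_bounded_def
proof (elim exE)
  fix c k d l assume f: "\<forall>n. f n \<le> c * (n + 1) ^ k" and g: "\<forall>n. g n \<le> d * (n + 1) ^ l"
  have "f n + g n \<le> (c + d) * (n + 1) ^ (k + l)" for n
  proof -
    have "(n + 1) ^ k \<le> (n + 1) ^ (k + l)" "(n + 1) ^ l \<le> (n + 1) ^ (k + l)"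
      by (intro power_increasing; simp)+
    then have "c * (n + 1) ^ k + d * (n + 1) ^ l \<le> c * (n + 1) ^ (k + l) + d * (n + 1) ^ (k + l)"
      by (intro add_mono mult_left_mono) auto
    then show ?thesis using f[rule_format, of n] g[rule_format, of n] by (simp add: algebra_simps)
  qed
  then show "\<exists>c k. \<forall>n. f n + g n \<le> c * (n + 1) ^ k" by blast
qed

lemma poly_bounded_mult: "poly_bounded f \<Longrightarrow> poly_bounded g \<Longrightarrow> poly_bounded (\<lambda>n. f n * g n)"
  unfolding poly_bounded_def
proof (elim exE)
  fix c k d l assume f: "\<forall>n. f n \<le> c * (n + 1) ^ k" and g: "\<forall>n. g n \<le> d * (n + 1) ^ l"
  have "f n * g n \<le> (c * d) * (n + 1) ^ (k + l)" for n
    using mult_mono[OF f[rule_format, of n] g[rule_format, of n]] by (simp add: power_add mult_ac)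
  then show "\<exists>c k. \<forall>n. f n * g n \<le> c * (n + 1) ^ k" by blast
qed

lemma poly_bounded_sum_list: "poly_bounded (\<lambda>n. \<Sum>P\<leftarrow>xs. n ^ g P)"
  by (induction xs) (simp_all add: poly_bounded_const poly_bounded_add poly_bounded_power)

text \<open>Every construct adds or multiplies the bounds of its parts; each level of loop nesting
  contributes a linear factor.\<close>

lemma poly_bounded_time: "poly_bounded f \<Longrightarrow> poly_bounded (\<lambda>n. time c (f n))"
  by (induction c) (auto simp only: time.simps intro!: poly_bounded_add poly_bounded_mult poly_bounded_const)

theorem theorem4p4:
  fixes sig :: "'p list" and ar :: "'p \<Rightarrow> nat" and V :: "'p inf_sentence set"
  assumes "distinct sig"
    and "finite V"
    and "\<forall>\<phi>\<in>V. is_INF sig ar \<phi>"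
  shows "\<exists>M c k. wf_tm M \<and>
           (\<forall>n J. wf_struct sig ar n J \<longrightarrow>
              (\<exists>t \<le> c * (n + 1) ^ k.
                 tm_computes_within M t (encode sig ar n J)
                   (encode sig ar n (lim ((\<lambda>\<phi>. INF_prop n \<phi>) ` V) J))))"
proof -
  obtain \<phi>s where \<phi>s: "set \<phi>s = V" using finite_list[OF assms(2)] by blast
  let ?c = "main_cmd sig ar \<phi>s"
  \<comment> \<open>The length of the input word, polynomial in \<open>n\<close> because the arities
    in \<open>sig\<close> are fixed.\<close>
  define N where "N n = n + 1 + (\<Sum>P\<leftarrow>sig. n ^ ar P)" for n :: nat
  have "poly_bounded N"
    unfolding N_def by (intro poly_bounded_add poly_bounded_id poly_bounded_const poly_bounded_sum_list)
  then have "poly_bounded (\<lambda>n. time ?c (N n) + 2 * N n + 5)"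
    by (intro poly_bounded_add poly_bounded_mult poly_bounded_const poly_bounded_time)
  then obtain a k where bound: "\<And>n. time ?c (N n) + 2 * N n + 5 \<le> a * (n + 1) ^ k"
    unfolding poly_bounded_def by blast
  obtain M where M: "wf_tm M" "\<And>w. w \<noteq> [] \<Longrightarrow> set w \<subseteq> {1..6} \<Longrightarrow>
      \<exists>t \<le> time ?c (length w) + 2 * length w + 5.
        tm_computes_within M t w (fst (exec ?c (w, \<lambda>v. if v = 0 then 0 else length w)))"
    using computes_exec[OF wf_main_cmd(2,1), of sig ar \<phi>s] by blast
  have "\<exists>t \<le> a * (n + 1) ^ k. tm_computes_within M t (encode sig ar n J)
      (encode sig ar n (lim ((\<lambda>\<phi>. INF_prop n \<phi>) ` V) J))" if J: "wf_struct sig ar n J" for n J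
  proof -
    let ?w = "encode sig ar n J"
    have N: "length ?w = N n" by (simp add: length_encode length_entries N_def)
    have ne: "?w \<noteq> []" by (simp add: encode_entries)
    have "fst (exec ?c (?w, \<lambda>v. if v = 0 then 0 else length ?w)) =
        encode sig ar n (lim ((\<lambda>\<phi>. INF_prop n \<phi>) ` V) J)"
      using exec_main_cmd[OF assms(1) _ J, of \<phi>s] assms(3) \<phi>s by simp
    with M(2)[OF ne encode_alphabet] N bound[of n] show ?thesis by (metis order_trans)
  qed
  with M(1) show ?thesis by blast
qed

end
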